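(* For all $m,d \in \mathbb{N}=\{1,2,\ldots\}$, we have \[ \mu(m, d) = \begin{cases} d & \text{if } m = 1 \text{ or } d = 1;\\ \frac{md}{2} & \text{if } m \geq 2 \text{ is even and } d \geq 2;\\ \frac{md}{2} + \left\lfloor \frac{2d}{3}\right\rfloor -\frac{d}{2} & \text{if } m \geq 3 \text{ is odd and } d \geq 2. \end{cases} \]
   Context: A (complete) flag $U^\bullet$ in $\mathbb{R}^d$ is a sequence of nested subspaces $\{0\}=U^0\subset U^1\subset\cdots\subset U^d=\mathbb{R}^d$ with $\dim U^i=i$ for each $i$. A set $S$ of vectors generates $U^\bullet$ if each $U^i$ is the span of some subset of $S$; equivalently, if $S$ contains a vector of $U^i\setminus U^{i-1}$ for each $i\in\{1,\ldots,d\}$. For flags $U_1^\bullet,\ldots,U_m^\bullet$ in $\mathbb{R}^d$ (indexed by the subscript), $\mu(U_1^\bullet,\ldots,U_m^\bullet)$ denotes the smallest possible size of a set of vectors that generates each of $U_1^\bullet,\ldots,U_m^\bullet$. For $m,d\in\mathbb{N}$, $\mu(m,d)$ denotes the maximum of $\mu(U_1^\bullet,\ldots,U_m^\bullet)$ over all $m$-tuples of flags in $\mathbb{R}^d$. *)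

theory Defs
  imports "HOL-Analysis.Analysis"
begin

text \<open>
  The ambient space is \<open>real ^ 'n\<close>, so \<open>d\<close> is \<open>CARD('n)\<close>. A flag is a function on \<open>nat\<close> of which
  only the values at \<open>0, \<dots>, d\<close> matter, and an \<open>m\<close>-tuple of flags is a function on \<open>nat\<close> of which
  only the values at \<open>1, \<dots>, m\<close> matter.
\<close>

definition complete_flag :: "(nat \<Rightarrow> (real ^ 'n) set) \<Rightarrow> bool" where
  "complete_flag U \<longleftrightarrow>
     U 0 = {0} \<and> U (CARD('n)) = UNIV \<and>
     (\<forall>i \<le> CARD('n). subspace (U i) \<and> dim (U i) = i) \<and>
     (\<forall>i < CARD('n). U i \<subset> U (Suc i))"

definition generates_flag :: "(real ^ 'n) set \<Rightarrow> (nat \<Rightarrow> (real ^ 'n) set) \<Rightarrow> bool" where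
  "generates_flag S U \<longleftrightarrow> (\<forall>i \<le> CARD('n). \<exists>T \<subseteq> S. U i = span T)"

text \<open>Finiteness of \<open>S\<close> is explicit because \<open>card\<close> is \<open>0\<close> on infinite sets.\<close>

definition mu_flags :: "nat \<Rightarrow> (nat \<Rightarrow> nat \<Rightarrow> (real ^ 'n) set) \<Rightarrow> nat" where
  "mu_flags m U =
     (LEAST k. \<exists>S. finite S \<and> card S = k \<and> (\<forall>j \<in> {1..m}. generates_flag S (U j)))"

text \<open>
  The number \<open>\<mu>(m, d)\<close>; the dimension \<open>d = CARD('n)\<close> is passed as the type argument \<open>TYPE('n)\<close>.
\<close>

definition mu_max :: "nat \<Rightarrow> 'n::finite itself \<Rightarrow> nat" where
  "mu_max m _ =
     Max {mu_flags m U | U :: nat \<Rightarrow> nat \<Rightarrow> (real ^ 'n) set. \<forall>j \<in> {1..m}. complete_flag (U j)}"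

end

theory Submission
  imports Defs "HOL-Combinatorics.Orbits"
begin

text \<open>
  Lower bound: on polynomials of degree less than \<open>s\<close>, take the \<open>m\<close> flags given by the order of
  vanishing at \<open>m\<close> distinct points. A vector has total codimension at most \<open>s - 1\<close> in these flags,
  so at least \<open>m s / 2\<close> vectors are needed. Splitting \<open>d\<close> into blocks of size 2 and 3 and stacking
  the corresponding flags adds up the rounded bounds.

  Upper bound: two flags have a common adapted basis, so it remains to generate three flags by
  \<open>5 d / 3\<close> vectors. The relative positions of the three pairs of flags match the \<open>3 d\<close> levels along
  cycles of length divisible by 3; adjacent levels have a common vector, so a cycle of length \<open>l\<close>
  costs \<open>\<lceil>l / 2\<rceil>\<close>. Odd cycles are merged in pairs whenever some vector links them. The only
  expensive cycles are the remaining triangles without a common vector, and these form a chain in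
  the product order of levels. Along a path of triples of levels through this chain, the dimension
  of the triple intersection grows from \<open>0\<close> to \<open>d\<close>, but not at the triangles; so there must be at
  least \<open>d\<close> local maxima along the other cycles, which forces these to be long or even enough to pay
  for the triangles.
\<close>

section \<open>Complete flags\<close>

text \<open>Truncated subtraction makes level \<open>0\<close> empty, so only levels from
  \<open>1\<close> on can be hit.\<close>

definition at_level :: "(nat \<Rightarrow> 'v set) \<Rightarrow> nat \<Rightarrow> 'v \<Rightarrow> bool" where
  "at_level A x v \<longleftrightarrow> v \<in> A x \<and> v \<notin> A (x - 1)"

lemma complete_flag_subspace:
  fixes A :: "nat \<Rightarrow> (real ^ 'n) set"
  shows "complete_flag A \<Longrightarrow> i \<le> CARD('n) \<Longrightarrow> subspace (A i)"
  by (simp add: complete_flag_def)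

lemma complete_flag_dim:
  fixes A :: "nat \<Rightarrow> (real ^ 'n) set"
  shows "complete_flag A \<Longrightarrow> i \<le> CARD('n) \<Longrightarrow> dim (A i) = i"
  by (simp add: complete_flag_def)

lemma complete_flag_top:
  fixes A :: "nat \<Rightarrow> (real ^ 'n) set"
  shows "complete_flag A \<Longrightarrow> A CARD('n) = UNIV"
  by (simp add: complete_flag_def)

lemma complete_flag_0:
  "complete_flag A \<Longrightarrow> A 0 = {0}"
  by (simp add: complete_flag_def)

lemma complete_flag_mono:
  fixes A :: "nat \<Rightarrow> (real ^ 'n) set"
  assumes "complete_flag A" "i \<le> j" "j \<le> CARD('n)"
  shows "A i \<subseteq> A j"
  using assms(2,3)
proof (induction j rule: dec_induct)
  case (step k)
  then have "A k \<subset> A (Suc k)"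
    using assms(1) by (simp add: complete_flag_def)
  with step show ?case by auto
qed auto

lemma complete_flag_at_level_ex:
  fixes A :: "nat \<Rightarrow> (real ^ 'n) set"
  assumes "complete_flag A" "x \<in> {1..CARD('n)}"
  shows "\<exists>v. at_level A x v"
proof -
  have "\<forall>i<CARD('n). A i \<subset> A (Suc i)" "x - 1 < CARD('n)" "Suc (x - 1) = x"
    using assms unfolding complete_flag_def by auto
  then have "A (x - 1) \<subset> A x"
    by metis
  then show ?thesis
    by (auto simp: at_level_def)
qed

text \<open>The quotient of \<open>A x\<close> by \<open>A (x - 1)\<close> is a line, spanned by the
  class of \<open>w\<close>.\<close>

lemma complete_flag_cancel:
  fixes A :: "nat \<Rightarrow> (real ^ 'n) set"
  assumes "complete_flag A" "x \<in> {1..CARD('n)}" "v \<in> A x" "at_level A x w"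
  shows "\<exists>c. v - c *\<^sub>R w \<in> A (x - 1)"
proof -
  let ?W = "A (x - 1)"
  have sub: "subspace ?W" "subspace (A x)"
    using assms by (auto intro!: complete_flag_subspace)
  have w: "w \<in> A x" "w \<notin> ?W"
    using assms by (auto simp: at_level_def)
  have dims: "dim ?W = x - 1" "dim (A x) = x"
    using assms by (auto intro!: complete_flag_dim)
  have "dim (insert w ?W) = x"
    using sub w dims assms by (simp add: dim_insert span_eq_iff[THEN iffD2])
  moreover have "insert w ?W \<subseteq> A x"
    using complete_flag_mono[OF assms(1), of "x - 1" x] assms w by auto
  ultimately have "span (insert w ?W) = A x"
    using sub dims by (metis dim_span span_minimal subspace_dim_equal subspace_span le_refl)
  with assms(3) obtain k where "v - k *\<^sub>R w \<in> span ?W"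
    using span_breakdown_eq by blast
  then show ?thesis
    using sub by (metis span_eq_iff)
qed

text \<open>A subset of \<open>S\<close> that spans \<open>A x\<close> cannot lie inside
  \<open>A (x - 1)\<close>. Conversely, one vector per level suffices: as successive quotients are
  lines, \<open>S \<inter> A i\<close> spans \<open>A i\<close> by induction.\<close>

lemma generates_flag_iff:
  fixes A :: "nat \<Rightarrow> (real ^ 'n) set"
  assumes "complete_flag A"
  shows "generates_flag S A \<longleftrightarrow> (\<forall>x\<in>{1..CARD('n)}. \<exists>v\<in>S. at_level A x v)"
proof
  assume gen: "generates_flag S A"
  show "\<forall>x\<in>{1..CARD('n)}. \<exists>v\<in>S. at_level A x v"
  proof
    fix x assume x: "x \<in> {1..CARD('n)}"
    obtain T where T: "T \<subseteq> S" "A x = span T"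
      using gen x unfolding generates_flag_def by auto
    have "\<not> T \<subseteq> A (x - 1)"
    proof
      assume "T \<subseteq> A (x - 1)"
      then have "A x \<subseteq> A (x - 1)"
        unfolding T(2) using x by (intro span_minimal complete_flag_subspace[OF assms]) auto
      then show False
        using complete_flag_at_level_ex[OF assms x] by (auto simp: at_level_def)
    qed
    then show "\<exists>v\<in>S. at_level A x v"
      using T by (auto simp: at_level_def span_base)
  qed
next
  assume hits: "\<forall>x\<in>{1..CARD('n)}. \<exists>v\<in>S. at_level A x v"
  have "A i = span (S \<inter> A i)" if "i \<le> CARD('n)" for i
    using that
  proof (induction i)
    case 0
    have "S \<inter> A 0 \<subseteq> {0}" using complete_flag_0[OF assms] by auto
    then have "span (S \<inter> A 0) = {0}"
      by (metis empty_subsetI insert_subset span_empty span_insert_0 subset_singletonD)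
    then show ?case using complete_flag_0[OF assms] by simp
  next
    case (Suc i)
    obtain w where w: "w \<in> S" "at_level A (Suc i) w"
      using hits Suc.prems by fastforce
    have "A i \<subseteq> A (Suc i)"
      using Suc.prems complete_flag_mono[OF assms] by auto
    then have IH: "A i \<subseteq> span (S \<inter> A (Suc i))"
      using Suc span_mono[of "S \<inter> A i" "S \<inter> A (Suc i)"] by auto
    have wS: "w \<in> span (S \<inter> A (Suc i))"
      using w by (auto simp: at_level_def intro: span_base)
    have "v \<in> span (S \<inter> A (Suc i))" if "v \<in> A (Suc i)" for v
    proof -
      obtain c where "v - c *\<^sub>R w \<in> A i"
        using complete_flag_cancel[OF assms, of "Suc i" v w] \<open>v \<in> A (Suc i)\<close> w Suc.prems by fastforce
      then have "(v - c *\<^sub>R w) + c *\<^sub>R w \<in> span (S \<inter> A (Suc i))"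
        using IH wS by (intro span_add span_mul) auto
      then show ?thesis by simp
    qed
    then have "A (Suc i) \<subseteq> span (S \<inter> A (Suc i))" by auto
    moreover have "span (S \<inter> A (Suc i)) \<subseteq> A (Suc i)"
      using complete_flag_subspace[OF assms Suc.prems] by (simp add: span_minimal)
    ultimately show ?case by simp
  qed
  then show "generates_flag S A"
    unfolding generates_flag_def by (meson inf_le1)
qed

text \<open>The Bruhat relative position of two flags, as a map on levels.\<close>

definition match :: "(nat \<Rightarrow> 'v set) \<Rightarrow> (nat \<Rightarrow> 'v set) \<Rightarrow> nat \<Rightarrow> nat" where
  "match A B x = (LEAST k. \<not> A x \<inter> B k \<subseteq> A (x - 1))"

text \<open>The defining condition is monotone in \<open>k\<close> because \<open>B\<close> grows.
  It holds at the top of \<open>B\<close> and fails at \<open>0\<close>, so its least solution is a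
  level and acts as a threshold.\<close>

lemma match_le:
  fixes A B :: "nat \<Rightarrow> (real ^ 'n) set"
  assumes "complete_flag A" "complete_flag B" "x \<in> {1..CARD('n)}"
  shows "match A B x \<in> {1..CARD('n)}"
    and "k \<le> CARD('n) \<Longrightarrow> \<not> A x \<inter> B k \<subseteq> A (x - 1) \<longleftrightarrow> match A B x \<le> k"
proof -
  let ?P = "\<lambda>k. \<not> A x \<inter> B k \<subseteq> A (x - 1)"
  have top: "?P CARD('n)"
    using complete_flag_at_level_ex[OF assms(1,3)] complete_flag_top[OF assms(2)]
    by (auto simp: at_level_def)
  have m: "?P (match A B x)"
    unfolding match_def by (rule LeastI[of ?P, OF top])
  have "\<not> ?P 0"
  proof -
    have "0 \<in> A (x - 1)"
      using assms(3) by (intro subspace_0 complete_flag_subspace[OF assms(1)]) auto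
    then show ?thesis
      using complete_flag_0[OF assms(2)] by auto
  qed
  with m have "match A B x \<noteq> 0" by metis
  moreover have le: "match A B x \<le> CARD('n)"
    unfolding match_def by (rule Least_le[of ?P, OF top])
  ultimately show "match A B x \<in> {1..CARD('n)}" by auto
  show "?P k \<longleftrightarrow> match A B x \<le> k" if "k \<le> CARD('n)"
  proof
    show "match A B x \<le> k" if "?P k"
      unfolding match_def by (rule Least_le[of ?P, OF that])
    show "?P k" if "match A B x \<le> k"
      using m complete_flag_mono[OF assms(2) that \<open>k \<le> CARD('n)\<close>] by auto
  qed
qed

text \<open>Relative position is symmetric: some \<open>v\<close> is at level \<open>x\<close> of
  \<open>A\<close> and level \<open>y\<close> of \<open>B\<close>, and no vector of
  \<open>A (x - 1)\<close> is at level \<open>y\<close> of \<open>B\<close>.\<close>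

lemma match_inverse:
  fixes A B :: "nat \<Rightarrow> (real ^ 'n) set"
  assumes A: "complete_flag A" and B: "complete_flag B" and x: "x \<in> {1..CARD('n)}"
  shows "match B A (match A B x) = x"
proof -
  define y where "y = match A B x"
  have y: "y \<in> {1..CARD('n)}"
    using match_le(1)[OF A B x] by (simp add: y_def)
  obtain v where v: "v \<in> A x" "v \<in> B y" "v \<notin> A (x - 1)"
    using match_le(2)[OF A B x, of y] y by (auto simp: y_def)
  have "\<not> match A B x \<le> y - 1" "y - 1 \<le> CARD('n)"
    using y by (auto simp: y_def)
  then have none: "A x \<inter> B (y - 1) \<subseteq> A (x - 1)"
    using match_le(2)[OF A B x] by blast
  have vB: "at_level B y v"
    using v none by (auto simp: at_level_def)
  have "match B A y \<le> x"
    using match_le(2)[OF B A y, of x] v vB x by (auto simp: at_level_def)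
  moreover have "\<not> match B A y \<le> x - 1"
  proof
    assume "match B A y \<le> x - 1"
    moreover have "x - 1 \<le> CARD('n)" using x by auto
    ultimately have "\<not> B y \<inter> A (x - 1) \<subseteq> B (y - 1)"
      using match_le(2)[OF B A y] by blast
    then obtain w where w: "w \<in> A (x - 1)" "at_level B y w"
      unfolding at_level_def by blast
    \<comment> \<open>Cancelling \<open>v\<close> against \<open>w\<close> leaves a vector of
      \<open>A x \<inter> B (y - 1)\<close>, which \<open>none\<close> pushes into
      \<open>A (x - 1)\<close>; then \<open>v\<close> would lie there too.\<close>
    obtain c where c: "v - c *\<^sub>R w \<in> B (y - 1)"
      using complete_flag_cancel[OF B y, of v w] v w by auto
    have subs: "subspace (A x)" "subspace (A (x - 1))"
      using x A by (auto intro!: complete_flag_subspace)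
    have "A (x - 1) \<subseteq> A x"
      using x by (intro complete_flag_mono[OF A]) auto
    with w have "w \<in> A x" by blast
    with subs have "v - c *\<^sub>R w \<in> A x"
      using v by (auto intro!: subspace_diff subspace_scale)
    then have "v - c *\<^sub>R w \<in> A (x - 1)"
      using none c by auto
    then have "(v - c *\<^sub>R w) + c *\<^sub>R w \<in> A (x - 1)"
      using w subs by (intro subspace_add subspace_scale) auto
    then show False using v by simp
  qed
  ultimately show ?thesis
    using x by (auto simp: y_def)
qed

text \<open>Two proper subspaces do not cover \<open>A x \<inter> B y\<close>: one of
  \<open>u\<close>, \<open>w\<close> and \<open>u + w\<close> avoids both \<open>A (x - 1)\<close>
  and \<open>B (y - 1)\<close>.\<close>

lemma common_level_vector:
  fixes A B :: "nat \<Rightarrow> (real ^ 'n) set"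
  assumes A: "complete_flag A" and B: "complete_flag B"
    and x: "x \<in> {1..CARD('n)}" and y: "y \<in> {1..CARD('n)}"
    and "match A B x \<le> y" "match B A y \<le> x"
  shows "\<exists>v. at_level A x v \<and> at_level B y v"
proof -
  obtain u where u: "u \<in> A x" "u \<in> B y" "u \<notin> A (x - 1)"
    using match_le(2)[OF A B x, of y] y assms by auto
  obtain w where w: "w \<in> A x" "w \<in> B y" "w \<notin> B (y - 1)"
    using match_le(2)[OF B A y, of x] x assms by auto
  have subs: "subspace (A x)" "subspace (B y)" "subspace (A (x - 1))" "subspace (B (y - 1))"
    using x y A B by (auto intro!: complete_flag_subspace)
  then have uw: "u + w \<in> A x" "u + w \<in> B y"
    using u w by (auto intro: subspace_add)
  have 1: "u + w \<notin> B (y - 1)" if "u \<in> B (y - 1)"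
    using subspace_diff[OF subs(4), of "u + w" u] that w by auto
  have 2: "u + w \<notin> A (x - 1)" if "w \<in> A (x - 1)"
    using subspace_diff[OF subs(3), of "u + w" w] that u by auto
  show ?thesis
    using u w uw 1 2 unfolding at_level_def by blast
qed

lemma dim_Int_step:
  fixes A :: "nat \<Rightarrow> (real ^ 'n) set"
  assumes "complete_flag A" "x \<in> {1..CARD('n)}" "subspace W"
  shows "dim (A x \<inter> W) \<le> dim (A (x - 1) \<inter> W) + 1"
proof (cases "A x \<inter> W \<subseteq> A (x - 1)")
  case True
  then have "dim (A x \<inter> W) \<le> dim (A (x - 1) \<inter> W)"
    by (intro dim_subset) auto
  then show ?thesis by simp
next
  case False
  then obtain w where w: "at_level A x w" "w \<in> W" by (auto simp: at_level_def)
  have "A x \<inter> W \<subseteq> span (insert w (A (x - 1) \<inter> W))"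
  proof
    fix v assume v: "v \<in> A x \<inter> W"
    obtain c where "v - c *\<^sub>R w \<in> A (x - 1)"
      using complete_flag_cancel[OF assms(1,2), of v w] v w by auto
    moreover have "v - c *\<^sub>R w \<in> W"
      using assms(3) v w by (auto intro!: subspace_diff subspace_scale)
    ultimately show "v \<in> span (insert w (A (x - 1) \<inter> W))"
      by (metis IntI span_base span_breakdown_eq)
  qed
  then have "dim (A x \<inter> W) \<le> dim (insert w (A (x - 1) \<inter> W))"
    by (metis dim_span dim_subset)
  also have "\<dots> \<le> dim (A (x - 1) \<inter> W) + 1"
    by (simp add: dim_insert)
  finally show ?thesis .
qed

section \<open>Flags that need many vectors\<close>

definition tail_zero :: "(nat \<Rightarrow> 'a) \<Rightarrow> nat \<Rightarrow> 'a::euclidean_space set" where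
  "tail_zero e b = {x. \<forall>i\<in>{b..<DIM('a)}. x \<bullet> e i = 0}"

definition block_poly :: "(nat \<Rightarrow> 'a::euclidean_space) \<Rightarrow> nat \<Rightarrow> nat \<Rightarrow> 'a \<Rightarrow> real poly" where
  "block_poly e b s x = (\<Sum>i<s. monom (x \<bullet> e (b + i)) i)"

text \<open>The index is shifted by \<open>b\<close>, so that a block starting at coordinate
  \<open>b\<close> supplies levels \<open>b\<close> to \<open>b + s\<close> of a flag; each level up
  lowers the required order of vanishing at \<open>t\<close> by one.\<close>

definition osculating :: "(nat \<Rightarrow> 'a::euclidean_space) \<Rightarrow> nat \<Rightarrow> nat \<Rightarrow> real \<Rightarrow> nat \<Rightarrow> 'a set" where
  "osculating e b s t i = {x \<in> tail_zero e (b + s). [:-t, 1:] ^ (b + s - i) dvd block_poly e b s x}"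

lemma subspace_tail_zero: "subspace (tail_zero e b)"
  by (auto simp: subspace_def tail_zero_def inner_add_left)

lemma tail_zero_mono: "b \<le> c \<Longrightarrow> tail_zero e b \<subseteq> tail_zero e c"
  by (auto simp: tail_zero_def)

lemma tail_zero_top: "tail_zero e DIM('a) = (UNIV :: 'a::euclidean_space set)"
  by (simp add: tail_zero_def)

lemma coeff_block_poly: "coeff (block_poly e b s x) k = (if k < s then x \<bullet> e (b + k) else 0)"
  by (simp add: block_poly_def coeff_sum)

lemma block_poly_add: "block_poly e b s (x + y) = block_poly e b s x + block_poly e b s y"
  by (rule poly_eqI) (simp add: coeff_block_poly inner_add_left)

lemma block_poly_scaleR: "block_poly e b s (c *\<^sub>R x) = smult c (block_poly e b s x)"
  by (rule poly_eqI) (simp add: coeff_block_poly)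

lemma degree_block_poly: "degree (block_poly e b s x) \<le> s - 1"
  by (rule degree_le) (auto simp: coeff_block_poly)

lemma subspace_osculating: "subspace (osculating e b s t i)"
  unfolding subspace_def osculating_def
  using subspace_tail_zero[of e "b + s"]
  by (auto simp: subspace_def block_poly_add block_poly_scaleR dvd_add dvd_smult)
     (simp add: block_poly_def)

text \<open>A stretch of a flag with coordinate subspaces as ends, so that consecutive stretches can
  be glued.\<close>

definition strict_chain :: "(nat \<Rightarrow> 'a::euclidean_space) \<Rightarrow> nat \<Rightarrow> nat \<Rightarrow> (nat \<Rightarrow> 'a set) \<Rightarrow> bool" where
  "strict_chain e b c U \<longleftrightarrow> U b = tail_zero e b \<and> U c = tail_zero e c \<and>
     (\<forall>i\<in>{b..c}. subspace (U i)) \<and> (\<forall>i\<in>{b..<c}. U i \<subset> U (Suc i))"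

definition forcing_chains :: "(nat \<Rightarrow> 'a::euclidean_space) \<Rightarrow> nat \<Rightarrow> nat \<Rightarrow> nat \<Rightarrow> nat \<Rightarrow> bool" where
  "forcing_chains e m b c N \<longleftrightarrow> (\<exists>U. (\<forall>j. strict_chain e b c (U j)) \<and>
     (\<forall>S. finite S \<longrightarrow> (\<forall>j\<in>{1..m}. \<forall>i\<in>{b..<c}. \<exists>x\<in>S. x \<in> U j (Suc i) - U j i) \<longrightarrow>
          N \<le> card (S \<inter> (tail_zero e c - tail_zero e b))))"

context
  fixes e :: "nat \<Rightarrow> 'a::euclidean_space"
  assumes e: "bij_betw e {..<DIM('a)} Basis"
begin

lemma inner_e: "i < DIM('a) \<Longrightarrow> j < DIM('a) \<Longrightarrow> e i \<bullet> e j = (if i = j then 1 else 0)"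
  using e inner_Basis[of "e i" "e j"] bij_betwE[OF e] by (auto simp: bij_betw_def inj_on_eq_iff)

lemma tail_zero_0: "tail_zero e 0 = {0}"
proof -
  have "x = 0" if "\<And>i. i < DIM('a) \<Longrightarrow> x \<bullet> e i = 0" for x
  proof (rule euclidean_eqI)
    fix b :: 'a assume "b \<in> Basis"
    then have "b \<in> e ` {..<DIM('a)}" using e by (simp add: bij_betw_def)
    with that show "x \<bullet> b = 0 \<bullet> b" by auto
  qed
  then show ?thesis by (auto simp: tail_zero_def)
qed

lemma block_poly_eq_0_iff:
  assumes "x \<in> tail_zero e (b + s)" "b + s \<le> DIM('a)"
  shows "block_poly e b s x = 0 \<longleftrightarrow> x \<in> tail_zero e b"
proof
  assume 0: "block_poly e b s x = 0"
  have "x \<bullet> e i = 0" if "b \<le> i" "i < DIM('a)" for i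
  proof (cases "i < b + s")
    case True
    then show ?thesis
      using coeff_block_poly[of e b s x "i - b"] that
      by (simp add: 0 less_diff_conv2 split: if_splits)
  next
    case False
    then show ?thesis using assms that by (auto simp: tail_zero_def)
  qed
  then show "x \<in> tail_zero e b" by (simp add: tail_zero_def)
next
  assume "x \<in> tail_zero e b"
  then show "block_poly e b s x = 0"
    using assms(2) by (intro poly_eqI) (auto simp: coeff_block_poly tail_zero_def)
qed

lemma block_poly_surj:
  assumes "b + s \<le> DIM('a)" "degree q < s"
  shows "\<exists>x \<in> tail_zero e (b + s). block_poly e b s x = q"
proof
  let ?x = "\<Sum>i<s. coeff q i *\<^sub>R e (b + i)"
  have inner: "?x \<bullet> e k = (if b \<le> k \<and> k < b + s then coeff q (k - b) else 0)" if k: "k < DIM('a)" for k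
  proof -
    have "?x \<bullet> e k = (\<Sum>i<s. if i = k - b \<and> b \<le> k then coeff q i else 0)"
      unfolding inner_sum_left using k assms(1)
      by (intro sum.cong refl) (auto simp: inner_e)
    also have "\<dots> = (if b \<le> k \<and> k < b + s then coeff q (k - b) else 0)"
      by auto
    finally show ?thesis .
  qed
  show "?x \<in> tail_zero e (b + s)"
    using inner by (auto simp: tail_zero_def)
  show "block_poly e b s ?x = q"
  proof (rule poly_eqI)
    fix k
    show "coeff (block_poly e b s ?x) k = coeff q k"
      using inner[of "b + k"] assms by (auto simp: coeff_block_poly coeff_eq_0)
  qed
qed

text \<open>A nonzero polynomial of degree less than \<open>s\<close> cannot vanish to order
  \<open>s\<close> at a point.\<close>

lemma osculating_bottom:
  assumes "b + s \<le> DIM('a)" "s \<ge> 1"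
  shows "osculating e b s t b = tail_zero e b"
proof -
  have "[:-t, 1:] ^ s dvd block_poly e b s x \<longleftrightarrow> block_poly e b s x = 0" for x
    using order_degree[of "block_poly e b s x" t] degree_block_poly[of e b s x] assms(2)
    by (fastforce simp: order_divides)
  then show ?thesis
    using tail_zero_mono[of b "b + s" e] block_poly_eq_0_iff[OF _ assms(1)]
    by (auto simp: osculating_def)
qed

lemma osculating_top: "osculating e b s t (b + s) = tail_zero e (b + s)"
  by (auto simp: osculating_def)

lemma osculating_strict:
  assumes "b + s \<le> DIM('a)" "i \<in> {b..<b + s}"
  shows "osculating e b s t i \<subset> osculating e b s t (Suc i)"
proof
  have "[:-t, 1:] ^ (b + s - Suc i) dvd [:-t, 1:] ^ (b + s - i)"
    by (intro le_imp_power_dvd) auto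
  then show "osculating e b s t i \<subseteq> osculating e b s t (Suc i)"
    using dvd_trans by (auto simp: osculating_def)
  \<comment> \<open>This power vanishes at \<open>t\<close> to exactly the order that separates the
    two levels.\<close>
  let ?q = "[:-t, 1:] ^ (b + s - Suc i)"
  have "degree ?q < s"
    using assms(2) by (auto simp: degree_power_eq)
  then obtain x where x: "x \<in> tail_zero e (b + s)" "block_poly e b s x = ?q"
    using block_poly_surj[OF assms(1)] by blast
  have "\<not> [:-t, 1:] ^ (b + s - i) dvd ?q"
    using order_power_n_n[of t "b + s - Suc i"] assms(2) by (auto simp: order_divides)
  with x have "x \<in> osculating e b s t (Suc i)" "x \<notin> osculating e b s t i"
    by (simp_all add: osculating_def)
  then show "osculating e b s t i \<noteq> osculating e b s t (Suc i)"
    by blast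
qed

text \<open>A vector meets the osculating flags of distinct points with total codimension at most
  \<open>s - 1\<close>, whereas the codimensions in one flag add up to \<open>s (s - 1) / 2\<close>.\<close>

lemma osculating_hitting_bound:
  assumes "b + s \<le> DIM('a)" "s \<ge> 2" "finite S"
    and hit: "\<And>j i. j \<in> {1..m} \<Longrightarrow> i \<in> {b..<b + s} \<Longrightarrow>
      \<exists>x\<in>S. x \<in> osculating e b s (real j) (Suc i) - osculating e b s (real j) i"
  shows "m * s \<le> 2 * card (S \<inter> (tail_zero e (b + s) - tail_zero e b))"
proof -
  define S' where "S' = S \<inter> (tail_zero e (b + s) - tail_zero e b)"
  define p where "p = block_poly e b s"
  have fin: "finite S'" using assms by (simp add: S'_def)
  have p0: "p x \<noteq> 0" if "x \<in> S'" for x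
    using that block_poly_eq_0_iff[OF _ assms(1)] by (auto simp: S'_def p_def)
  have upper: "(\<Sum>j=1..m. order (real j) (p x)) \<le> s - 1" if "x \<in> S'" for x
  proof -
    have "(\<Sum>j=1..m. order (real j) (p x)) = (\<Sum>t\<in>real ` {1..m}. order t (p x))"
      by (subst sum.reindex) (auto simp: inj_on_def)
    \<comment> \<open>Points that are not roots contribute order \<open>0\<close>.\<close>
    also have "\<dots> = (\<Sum>t\<in>real ` {1..m} \<inter> {t. poly (p x) t = 0}. order t (p x))"
      using p0[OF that] by (intro sum.mono_neutral_right) (auto simp: order_root)
    also have "\<dots> \<le> (\<Sum>t | poly (p x) t = 0. order t (p x))"
      using poly_roots_finite[OF p0[OF that]] by (intro sum_mono2) auto
    also have "\<dots> \<le> s - 1"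
      using sum_order_le_degree[OF p0[OF that]] degree_block_poly[of e b s x]
      by (simp add: p_def)
    finally show ?thesis .
  qed
  have lower: "(\<Sum>k<s. k) \<le> (\<Sum>x\<in>S'. order (real j) (p x))" if j: "j \<in> {1..m}" for j
  proof -
    \<comment> \<open>Serving the step above level \<open>b + s - Suc k\<close> takes a polynomial
      of order exactly \<open>k\<close>, so every order below \<open>s\<close> occurs.\<close>
    have "{..<s} \<subseteq> (\<lambda>x. order (real j) (p x)) ` S'"
    proof
      fix k assume k: "k \<in> {..<s}"
      define i where "i = b + s - Suc k"
      have i: "i \<in> {b..<b + s}" "b + s - i = Suc k" "b + s - Suc i = k"
        using k by (auto simp: i_def)
      obtain x where x: "x \<in> S" "x \<in> osculating e b s (real j) (Suc i) - osculating e b s (real j) i"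
        using hit[OF j i(1)] by blast
      then have xt: "x \<in> tail_zero e (b + s)"
        and ord: "[:-real j, 1:] ^ k dvd p x" "\<not> [:-real j, 1:] ^ Suc k dvd p x"
        by (auto simp: osculating_def i p_def)
      then have "x \<in> S'"
        using block_poly_eq_0_iff[OF xt assms(1)] x(1) by (auto simp: S'_def p_def)
      moreover have "order (real j) (p x) = k"
        using order_unique_lemma[OF ord] .
      ultimately show "k \<in> (\<lambda>x. order (real j) (p x)) ` S'" by auto
    qed
    then have "(\<Sum>k<s. k) \<le> (\<Sum>k\<in>(\<lambda>x. order (real j) (p x)) ` S'. k)"
      using fin by (intro sum_mono2) auto
    also have "\<dots> \<le> (\<Sum>x\<in>S'. order (real j) (p x))"
      using sum_image_le[OF fin, of "\<lambda>k. k" "\<lambda>x. order (real j) (p x)"] by (simp add: o_def)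
    finally show ?thesis .
  qed
  have "m * (\<Sum>k<s. k) = (\<Sum>j=1..m. \<Sum>k<s. k)" by simp
  also have "\<dots> \<le> (\<Sum>j=1..m. \<Sum>x\<in>S'. order (real j) (p x))"
    by (intro sum_mono lower)
  also have "\<dots> = (\<Sum>x\<in>S'. \<Sum>j=1..m. order (real j) (p x))"
    by (rule sum.swap)
  also have "\<dots> \<le> (\<Sum>x\<in>S'. s - 1)"
    by (intro sum_mono upper)
  finally have "m * (\<Sum>k<s. k) \<le> card S' * (s - 1)" by simp
  moreover have "2 * (\<Sum>k<s. k) = s * (s - 1)"
    by (induction s) (auto simp: algebra_simps)
  \<comment> \<open>Both sides of the double count carry the factor \<open>s - 1\<close>, which is
    positive since \<open>s \<ge> 2\<close>.\<close>
  ultimately have "(m * s) * (s - 1) \<le> (2 * card S') * (s - 1)"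
    by (metis mult.assoc mult.left_commute mult_le_mono2)
  then show ?thesis
    using assms(2) by (simp add: S'_def)
qed

text \<open>The \<open>j\<close>-th chain uses the point \<open>j\<close>. \<open>N\<close> is
  \<open>m * s / 2\<close> rounded up; this rounding is the gain of blocks of size 3 when
  \<open>m\<close> is odd.\<close>

lemma forcing_chains_block:
  assumes "b + s \<le> DIM('a)" "s \<ge> 2" "N = (m * s + 1) div 2"
  shows "forcing_chains e m b (b + s) N"
proof -
  let ?U = "\<lambda>j. osculating e b s (real j)"
  have "strict_chain e b (b + s) (?U j)" for j
    using assms(1,2) unfolding strict_chain_def
    by (simp add: osculating_bottom osculating_top subspace_osculating osculating_strict)
  moreover have "N \<le> card (S \<inter> (tail_zero e (b + s) - tail_zero e b))"
    if "finite S" "\<forall>j\<in>{1..m}. \<forall>i\<in>{b..<b + s}. \<exists>x\<in>S. x \<in> ?U j (Suc i) - ?U j i" for S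
    using osculating_hitting_bound[OF assms(1,2) that(1), of m] that(2) assms(3) by auto
  ultimately show ?thesis
    unfolding forcing_chains_def by (intro exI[of _ ?U]) blast
qed

text \<open>The vectors that serve the levels between \<open>b\<close> and \<open>c\<close> lie in \<open>tail_zero e c - tail_zero e b\<close>,
  so the numbers needed in consecutive blocks add up.\<close>

lemma forcing_chains_trans:
  assumes "forcing_chains e m a b N" "forcing_chains e m b c N'" "a \<le> b" "b \<le> c"
  shows "forcing_chains e m a c (N + N')"
proof -
  obtain U where cU: "\<forall>j. strict_chain e a b (U j)"
    and UN: "\<forall>S. finite S \<longrightarrow> (\<forall>j\<in>{1..m}. \<forall>i\<in>{a..<b}. \<exists>x\<in>S. x \<in> U j (Suc i) - U j i) \<longrightarrow>
          N \<le> card (S \<inter> (tail_zero e b - tail_zero e a))"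
    using assms(1) unfolding forcing_chains_def by (elim exE conjE) (rule that)
  obtain V where cV: "\<forall>j. strict_chain e b c (V j)"
    and VN: "\<forall>S. finite S \<longrightarrow> (\<forall>j\<in>{1..m}. \<forall>i\<in>{b..<c}. \<exists>x\<in>S. x \<in> V j (Suc i) - V j i) \<longrightarrow>
          N' \<le> card (S \<inter> (tail_zero e c - tail_zero e b))"
    using assms(2) unfolding forcing_chains_def by (elim exE conjE) (rule that)
  have U: "U j a = tail_zero e a" "U j b = tail_zero e b"
      "i \<in> {a..b} \<Longrightarrow> subspace (U j i)" "i \<in> {a..<b} \<Longrightarrow> U j i \<subset> U j (Suc i)" for i j
    using cU unfolding strict_chain_def by blast+
  have V: "V j b = tail_zero e b" "V j c = tail_zero e c"
      "i \<in> {b..c} \<Longrightarrow> subspace (V j i)" "i \<in> {b..<c} \<Longrightarrow> V j i \<subset> V j (Suc i)" for i j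
    using cV unfolding strict_chain_def by blast+
  \<comment> \<open>Both chains have the space \<open>tail_zero e b\<close> at index
    \<open>b\<close>, so either may be used there.\<close>
  define W where "W j i = (if i \<le> b then U j i else V j i)" for j i
  have WU: "W j i = U j i" if "i \<le> b" for j i
    using that by (simp add: W_def)
  have WV: "W j i = V j i" if "b \<le> i" for j i
    using that U(2) V(1) by (simp add: W_def)
  have count: "N + N' \<le> card (S \<inter> (tail_zero e c - tail_zero e a))"
    if S: "finite S" and hit: "\<forall>j\<in>{1..m}. \<forall>i\<in>{a..<c}. \<exists>x\<in>S. x \<in> W j (Suc i) - W j i" for S
  proof -
    have "N \<le> card (S \<inter> (tail_zero e b - tail_zero e a))"
    proof (rule UN[rule_format, OF S])
      fix j i assume "j \<in> {1..m}" "i \<in> {a..<b}"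
      then show "\<exists>x\<in>S. x \<in> U j (Suc i) - U j i"
        using hit[rule_format, of j i] assms by (auto simp: WU)
    qed
    moreover have "N' \<le> card (S \<inter> (tail_zero e c - tail_zero e b))"
    proof (rule VN[rule_format, OF S])
      fix j i assume "j \<in> {1..m}" "i \<in> {b..<c}"
      then show "\<exists>x\<in>S. x \<in> V j (Suc i) - V j i"
        using hit[rule_format, of j i] assms by (auto simp: WV)
    qed
    moreover have "S \<inter> (tail_zero e c - tail_zero e a) =
        S \<inter> (tail_zero e b - tail_zero e a) \<union> S \<inter> (tail_zero e c - tail_zero e b)"
      using tail_zero_mono[OF assms(3)] tail_zero_mono[OF assms(4)] by blast
    moreover have "card (S \<inter> (tail_zero e b - tail_zero e a) \<union> S \<inter> (tail_zero e c - tail_zero e b))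
        = card (S \<inter> (tail_zero e b - tail_zero e a)) + card (S \<inter> (tail_zero e c - tail_zero e b))"
      using S by (intro card_Un_disjoint) auto
    ultimately show ?thesis by simp
  qed
  have chain: "strict_chain e a c (W j)" for j
    unfolding strict_chain_def
  proof (intro conjI ballI)
    show "subspace (W j i)" if "i \<in> {a..c}" for i
      using U(3)[of i j] V(3)[of i j] that by (auto simp: W_def)
    show "W j i \<subset> W j (Suc i)" if "i \<in> {a..<c}" for i
    proof (cases "i < b")
      case True
      then show ?thesis using U(4)[of i j] that by (simp add: WU)
    next
      case False
      then show ?thesis using V(4)[of i j] that by (simp add: WV)
    qed
  qed (use assms U V in \<open>simp_all add: WU WV\<close>)
  show ?thesis
    unfolding forcing_chains_def using chain count by (intro exI[of _ W]) blast
qed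

lemma forcing_chains_refl: "forcing_chains e m b b 0"
  unfolding forcing_chains_def
  by (intro exI[of _ "\<lambda>j. tail_zero e"]) (auto simp: strict_chain_def subspace_tail_zero)

lemma forcing_chains_repeat:
  assumes "s \<ge> 2" "b + q * s \<le> DIM('a)" "N = q * ((m * s + 1) div 2)"
  shows "forcing_chains e m b (b + q * s) N"
  using assms(2,3)
proof (induction q arbitrary: N)
  case 0
  then show ?case by (simp add: forcing_chains_refl)
next
  case (Suc q)
  have "forcing_chains e m b (b + q * s) (q * ((m * s + 1) div 2))"
    using Suc by auto
  moreover have "forcing_chains e m (b + q * s) (b + q * s + s) ((m * s + 1) div 2)"
    using Suc.prems assms(1) by (intro forcing_chains_block) auto
  ultimately show ?case
    using forcing_chains_trans[of m b "b + q * s" "q * ((m * s + 1) div 2)" "b + q * s + s"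
        "(m * s + 1) div 2"] Suc.prems
    by (simp add: add_ac)
qed

end

section \<open>Complete flags from strict chains\<close>

lemma complete_flag_of_strict_chain:
  fixes U :: "nat \<Rightarrow> (real ^ 'n) set"
  assumes "U 0 = {0}" "U (CARD('n)) = UNIV" "\<And>i. i \<le> CARD('n) \<Longrightarrow> subspace (U i)"
    and strict: "\<And>i. i < CARD('n) \<Longrightarrow> U i \<subset> U (Suc i)"
  shows "complete_flag U"
proof -
  have step: "dim (U i) + 1 \<le> dim (U (Suc i))" if "i < CARD('n)" for i
    using dim_psubset[of "U i" "U (Suc i)"] strict[OF that] assms(3)[of i] assms(3)[of "Suc i"] that
    by (simp add: span_eq_iff[THEN iffD2])
  have up: "dim (U i) + k \<le> dim (U (i + k))" if "i + k \<le> CARD('n)" for i k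
    using that
  proof (induction k)
    case (Suc k)
    then show ?case using step[of "i + k"] by simp
  qed simp
  \<comment> \<open>Counting the steps from the bottom bounds \<open>dim (U i)\<close> below by
    \<open>i\<close>; counting those up to the whole space bounds it above by
    \<open>i\<close>.\<close>
  have "dim (U i) = i" if "i \<le> CARD('n)" for i
    using up[of 0 i] up[of i "CARD('n) - i"] that assms(1,2) by simp
  then show ?thesis
    using assms by (simp add: complete_flag_def)
qed

lemma complete_flag_ex: "\<exists>A :: nat \<Rightarrow> (real ^ 'n) set. complete_flag A"
proof -
  obtain e :: "nat \<Rightarrow> real ^ 'n" where e: "bij_betw e {..<DIM(real ^ 'n)} Basis"
    using ex_bij_betw_nat_finite[of "Basis :: (real ^ 'n) set"] by (auto simp: atLeast0LessThan)
  have "tail_zero e i \<subset> tail_zero e (Suc i)" if "i < CARD('n)" for i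
  proof -
    have "e i \<in> tail_zero e (Suc i)" "e i \<notin> tail_zero e i"
      using inner_e[OF e] that by (auto simp: tail_zero_def)
    then show ?thesis
      using tail_zero_mono[of i "Suc i" e] by auto
  qed
  then have "complete_flag (tail_zero e)"
    using tail_zero_0[OF e] tail_zero_top[of e]
    by (intro complete_flag_of_strict_chain) (auto simp: subspace_tail_zero)
  then show ?thesis by blast
qed

text \<open>Each of the \<open>p\<close> blocks of size 2 costs \<open>m\<close> vectors, each of
  the \<open>q\<close> blocks of size 3 costs \<open>3 * m / 2\<close> rounded up; stacking adds the
  costs.\<close>

lemma flags_needing_many_vectors:
  assumes "2 * p + 3 * q = CARD('n)"
  shows "\<exists>U :: nat \<Rightarrow> nat \<Rightarrow> (real ^ 'n) set. (\<forall>j. complete_flag (U j)) \<and>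
    (\<forall>S. finite S \<longrightarrow> (\<forall>j\<in>{1..m}. generates_flag S (U j)) \<longrightarrow>
       p * m + q * ((3 * m + 1) div 2) \<le> card S)"
proof -
  obtain e :: "nat \<Rightarrow> real ^ 'n" where e: "bij_betw e {..<DIM(real ^ 'n)} Basis"
    using ex_bij_betw_nat_finite[of "Basis :: (real ^ 'n) set"] by (auto simp: atLeast0LessThan)
  let ?N = "p * m + q * ((3 * m + 1) div 2)"
  have "forcing_chains e m 0 (0 + p * 2) (p * m)"
    using assms by (intro forcing_chains_repeat[OF e]) auto
  moreover have "forcing_chains e m (0 + p * 2) (0 + p * 2 + q * 3) (q * ((3 * m + 1) div 2))"
    using assms by (intro forcing_chains_repeat[OF e]) (auto simp: mult.commute)
  ultimately have "forcing_chains e m 0 (0 + p * 2 + q * 3) ?N"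
    by (intro forcing_chains_trans[OF e]) auto
  then have "forcing_chains e m 0 (CARD('n)) ?N"
    using assms by (simp add: mult.commute)
  then obtain U where cU: "\<forall>j. strict_chain e 0 (CARD('n)) (U j)"
    and N: "\<forall>S. finite S \<longrightarrow>
        (\<forall>j\<in>{1..m}. \<forall>i\<in>{0..<CARD('n)}. \<exists>x\<in>S. x \<in> U j (Suc i) - U j i) \<longrightarrow>
        ?N \<le> card (S \<inter> (tail_zero e (CARD('n)) - tail_zero e 0))"
    unfolding forcing_chains_def by (elim exE conjE) (rule that)
  have U: "U j 0 = tail_zero e 0" "U j (CARD('n)) = tail_zero e (CARD('n))"
      "i \<in> {0..CARD('n)} \<Longrightarrow> subspace (U j i)"
      "i \<in> {0..<CARD('n)} \<Longrightarrow> U j i \<subset> U j (Suc i)" for i j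
    using cU unfolding strict_chain_def by blast+
  have flag: "complete_flag (U j)" for j
    using U tail_zero_0[OF e] tail_zero_top[of e] by (intro complete_flag_of_strict_chain) auto
  have "?N \<le> card S" if S: "finite S" "\<forall>j\<in>{1..m}. generates_flag S (U j)" for S
  proof -
    have "\<exists>x\<in>S. x \<in> U j (Suc i) - U j i" if "j \<in> {1..m}" "i \<in> {0..<CARD('n)}" for j i
    proof -
      have "\<exists>v\<in>S. at_level (U j) (Suc i) v"
        using S(2) that generates_flag_iff[OF flag, of S j] by auto
      then show ?thesis by (auto simp: at_level_def)
    qed
    then have "?N \<le> card (S \<inter> (tail_zero e (CARD('n)) - tail_zero e 0))"
      using N[rule_format, OF S(1)] by blast
    also have "\<dots> \<le> card S"
      using S(1) by (intro card_mono) auto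
    finally show ?thesis .
  qed
  with flag show ?thesis by blast
qed

section \<open>Three flags\<close>

locale three_flags =
  fixes V :: "nat \<Rightarrow> nat \<Rightarrow> (real ^ 'n) set" and d :: nat
  assumes d_eq: "d = CARD('n)" and flag: "j < 3 \<Longrightarrow> complete_flag (V j)"
begin

text \<open>A node is a flag index with a level of that flag; generating all three flags means
  hitting every node.\<close>

definition nodes :: "(nat \<times> nat) set" where
  "nodes = {..<3} \<times> {1..d}"

definition partner :: "nat \<Rightarrow> nat \<Rightarrow> nat \<Rightarrow> nat" where
  "partner j k = match (V j) (V k)"

definition hits :: "real ^ 'n \<Rightarrow> nat \<times> nat \<Rightarrow> bool" where
  "hits v u \<longleftrightarrow> at_level (V (fst u)) (snd u) v"

definition linked :: "nat \<times> nat \<Rightarrow> nat \<times> nat \<Rightarrow> bool" where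
  "linked u w \<longleftrightarrow> (\<exists>v. hits v u \<and> hits v w)"

definition coverable :: "(nat \<times> nat) set \<Rightarrow> nat \<Rightarrow> bool" where
  "coverable S n \<longleftrightarrow> (\<exists>W. finite W \<and> card W \<le> n \<and> (\<forall>u\<in>S. \<exists>v\<in>W. hits v u))"

text \<open>The three partner maps \<open>0 \<rightarrow> 1 \<rightarrow> 2 \<rightarrow> 0\<close> combine into one permutation of the nodes; its
  cycles have length divisible by 3.\<close>

definition succ :: "nat \<times> nat \<Rightarrow> nat \<times> nat" where
  "succ u = (if u \<in> nodes
     then ((fst u + 1) mod 3, partner (fst u) ((fst u + 1) mod 3) (snd u)) else u)"

lemma finite_nodes: "finite nodes"
  by (simp add: nodes_def)

lemma card_nodes: "card nodes = 3 * d"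
  by (simp add: nodes_def)

lemma partner_range: "j < 3 \<Longrightarrow> k < 3 \<Longrightarrow> x \<in> {1..d} \<Longrightarrow> partner j k x \<in> {1..d}"
  unfolding partner_def d_eq by (rule match_le(1)) (auto intro: flag)

lemma partner_inverse: "j < 3 \<Longrightarrow> k < 3 \<Longrightarrow> x \<in> {1..d} \<Longrightarrow> partner k j (partner j k x) = x"
  unfolding partner_def d_eq by (rule match_inverse) (auto intro: flag)

lemma linkedI:
  assumes "j < 3" "k < 3" "x \<in> {1..d}" "y \<in> {1..d}" "partner j k x \<le> y" "partner k j y \<le> x"
  shows "linked (j, x) (k, y)"
  using common_level_vector[OF flag flag assms(3,4)[unfolded d_eq]] assms
  by (simp add: linked_def hits_def partner_def)

lemma hits_ex: "u \<in> nodes \<Longrightarrow> \<exists>v. hits v u"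
  using complete_flag_at_level_ex[OF flag] by (auto simp: nodes_def hits_def d_eq[symmetric])

lemma succ_in_nodes: "u \<in> nodes \<Longrightarrow> succ u \<in> nodes"
  using partner_range by (auto simp: succ_def nodes_def)

lemma linked_succ:
  assumes "u \<in> nodes"
  shows "linked u (succ u)"
proof -
  obtain j x where u: "u = (j, x)" "j < 3" "x \<in> {1..d}"
    using assms by (auto simp: nodes_def)
  let ?k = "(j + 1) mod 3"
  have "linked (j, x) (?k, partner j ?k x)"
    using u partner_range[of j ?k x] partner_inverse[of j ?k x] by (intro linkedI) auto
  then show ?thesis
    using assms u by (simp add: succ_def)
qed

text \<open>Adding 1 modulo 3 is injective on flag indices and \<open>partner\<close> is invertible
  on levels; on a finite set injectivity is enough.\<close>

lemma succ_permutes: "succ permutes nodes"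
proof (rule bij_imp_permutes)
  have "inj_on succ nodes"
  proof (rule inj_onI)
    fix u w assume uw: "u \<in> nodes" "w \<in> nodes" "succ u = succ w"
    have lt: "fst u < 3" "fst w < 3"
      using uw by (auto simp: nodes_def)
    have "(fst u + 1) mod 3 = (fst w + 1) mod 3"
      using uw by (simp add: succ_def)
    moreover have "i = i'" if "i < 3" "i' < 3" "(i + 1) mod 3 = (i' + 1) mod 3" for i i' :: nat
    proof -
      have "i \<in> {0, 1, 2}" "i' \<in> {0, 1, 2}" using that(1,2) by auto
      then show ?thesis using that(3) by auto
    qed
    ultimately have j: "fst u = fst w"
      using lt by blast
    have "partner (fst u) ((fst u + 1) mod 3) (snd u) = partner (fst u) ((fst u + 1) mod 3) (snd w)"
      using uw j by (simp add: succ_def)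
    moreover have "partner ((fst u + 1) mod 3) (fst u) (partner (fst u) ((fst u + 1) mod 3) x) = x"
      if "x \<in> {1..d}" for x
      using that lt by (intro partner_inverse) auto
    moreover have "snd u \<in> {1..d}" "snd w \<in> {1..d}"
      using uw by (auto simp: nodes_def)
    ultimately have "snd u = snd w" by metis
    with j show "u = w" by (simp add: prod_eq_iff)
  qed
  moreover have "succ ` nodes \<subseteq> nodes"
    using succ_in_nodes by auto
  ultimately show "bij_betw succ nodes nodes"
    using finite_nodes by (simp add: bij_betw_def endo_inj_surj)
  show "succ u = u" if "u \<notin> nodes" for u
    using that by (simp add: succ_def)
qed

section \<open>Covering paths and cycles of nodes by few vectors\<close>

lemma coverable_mono: "coverable S n \<Longrightarrow> n \<le> n' \<Longrightarrow> coverable S n'"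
  unfolding coverable_def by (meson le_trans)

lemma coverable_Un: "coverable S n \<Longrightarrow> coverable S' n' \<Longrightarrow> coverable (S \<union> S') (n + n')"
  unfolding coverable_def
proof (elim exE conjE)
  fix W W'
  assume *: "finite W" "card W \<le> n" "\<forall>u\<in>S. \<exists>v\<in>W. hits v u"
    "finite W'" "card W' \<le> n'" "\<forall>u\<in>S'. \<exists>v\<in>W'. hits v u"
  then have "card (W \<union> W') \<le> n + n'"
    using card_Un_le[of W W'] by linarith
  with * show "\<exists>W. finite W \<and> card W \<le> n + n' \<and> (\<forall>u\<in>S \<union> S'. \<exists>v\<in>W. hits v u)"
    by (intro exI[of _ "W \<union> W'"]) auto
qed

lemma coverable_Union:
  assumes "finite X" "\<And>Z. Z \<in> X \<Longrightarrow> coverable Z (c Z)"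
  shows "coverable (\<Union>X) (\<Sum>Z\<in>X. c Z)"
  using assms
proof (induction X rule: finite_induct)
  case empty
  show ?case by (auto simp: coverable_def intro: exI[of _ "{}"])
next
  case (insert Z X)
  then show ?case using coverable_Un[of Z "c Z" "\<Union>X"] by simp
qed

lemma coverable_one: "coverable S 1" if "\<forall>u\<in>S. hits v u"
  unfolding coverable_def using that by (intro exI[of _ "{v}"]) auto

text \<open>Consecutive nodes are paired off and share a vector; a path of odd length leaves one
  node, which gets its own.\<close>

lemma coverable_path:
  assumes "set l \<subseteq> nodes" "successively linked l"
  shows "coverable (set l) ((length l + 1) div 2)"
  using assms
proof (induction l rule: induct_list012)
  case 1
  show ?case by (auto simp: coverable_def intro: exI[of _ "{}"])
next
  case (2 u)
  then obtain v where "hits v u" using hits_ex[of u] by auto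
  then show ?case using coverable_one[of "{u}" v] by simp
next
  case (3 u w l)
  have l: "coverable (set l) ((length l + 1) div 2)"
    using 3 by (auto simp: successively_Cons)
  obtain v where "hits v u" "hits v w"
    using 3 by (auto simp: linked_def)
  then have "coverable {u, w} 1"
    by (intro coverable_one) auto
  from coverable_Un[OF this l] show ?case by (simp add: insert_commute)
qed

text \<open>The cycle can be cut open just before any chosen \<open>u\<close>; the list then ends at
  the predecessor of \<open>u\<close>.\<close>

lemma cycle_list:
  assumes "cyclic_on succ Z" "Z \<subseteq> nodes" "u \<in> Z"
  shows "\<exists>l. l \<noteq> [] \<and> set l = Z \<and> length l = card Z \<and> hd l = u \<and> succ (last l) = u \<and>
    successively linked l"
proof -
  have Z: "Z = orbit succ u"
    using orbit_cyclic_eq3[OF assms(1,3)] by simp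
  have self: "u \<in> orbit succ u"
    using assms(3) Z by simp
  define p where "p = funpow_dist1 succ u u"
  define l where "l = map (\<lambda>n. (succ ^^ n) u) [0..<p]"
  have p: "p \<ge> 1" by (simp add: p_def)
  have set: "set l = Z"
    using orbit_conv_funpow_dist1[OF self] by (simp only: l_def Z p_def set_map set_upt)
  have "inj_on (\<lambda>n. (succ ^^ n) u) {0..<p}"
    using inj_on_funpow_dist1[OF self] by (simp only: p_def)
  then have "distinct l"
    by (simp add: l_def distinct_map)
  then have len: "length l = card Z"
    using set distinct_card by metis
  have ne: "l \<noteq> []" and hd: "hd l = u"
    using p by (auto simp: l_def hd_map)
  have "last l = (succ ^^ (p - 1)) u"
    using p by (simp add: l_def last_map)
  then have "succ (last l) = (succ ^^ p) u"
    using p by (metis Suc_diff_le diff_Suc_1 funpow.simps(2) o_apply One_nat_def)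
  also have "\<dots> = u"
    using funpow_dist1_prop[OF self] by (simp only: p_def)
  finally have last: "succ (last l) = u" .
  have "linked (l ! n) (l ! Suc n)" if "Suc n < length l" for n
  proof -
    have "l ! n \<in> nodes"
      using that set assms(2) nth_mem[of n l] by auto
    moreover have "l ! Suc n = succ (l ! n)"
      using that by (simp add: l_def)
    ultimately show ?thesis using linked_succ by simp
  qed
  then have "successively linked l"
    by (simp add: successively_conv_nth)
  with ne set len hd last show ?thesis by blast
qed

lemma coverable_cycle:
  assumes "cyclic_on succ Z" "Z \<subseteq> nodes"
  shows "coverable Z ((card Z + 1) div 2)"
proof -
  obtain u where "u \<in> Z"
    using assms(1) by (auto simp: cyclic_on_def)
  from cycle_list[OF assms this] obtain l where
    "set l = Z" "length l = card Z" "successively linked l" by blast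
  with coverable_path[of l] assms(2) show ?thesis by simp
qed

text \<open>A link between two cycles joins them to one path, so that two odd cycles cost no more
  than an even one.\<close>

lemma coverable_linked_cycles:
  assumes "cyclic_on succ Z" "Z \<subseteq> nodes" "cyclic_on succ Z'" "Z' \<subseteq> nodes"
    and "u \<in> Z" "w \<in> Z'" "linked u w"
  shows "coverable (Z \<union> Z') ((card Z + card Z' + 1) div 2)"
proof -
  obtain l' where l': "l' \<noteq> []" "set l' = Z'" "length l' = card Z'" "hd l' = w" "successively linked l'"
    using cycle_list[OF assms(3,4,6)] by blast
  \<comment> \<open>Cutting \<open>Z\<close> before \<open>succ u\<close> makes its list end at
    \<open>u\<close>, ready to be continued by \<open>w\<close>.\<close>
  have "succ u \<in> Z"
    using assms(1,5) by (rule cyclic_on_inI)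
  from cycle_list[OF assms(1,2) this] obtain l where
    l: "l \<noteq> []" "set l = Z" "length l = card Z" "succ (last l) = succ u" "successively linked l"
    by blast
  have "last l = u"
    using l(4) permutes_inj[OF succ_permutes] by (simp add: inj_eq)
  then have "successively linked (l @ l')"
    using l l' assms(7) by (simp add: successively_append_iff)
  then show ?thesis
    using coverable_path[of "l @ l'"] l l' assms(2,4) by simp
qed

text \<open>\<open>succ\<close> injects each layer of \<open>Z\<close> into the next; going round
  the three flags, all layers have the same size.\<close>

lemma card_cycle_layer:
  assumes "cyclic_on succ Z" "Z \<subseteq> nodes" "j < 3"
  shows "card Z = 3 * card {u \<in> Z. fst u = j}"
proof -
  let ?c = "\<lambda>j. card {u \<in> Z. fst u = j}"
  have fin: "finite Z"
    using assms(2) finite_nodes finite_subset by blast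
  have step: "?c j \<le> ?c ((j + 1) mod 3)" for j
  proof (rule card_inj_on_le[of succ])
    show "inj_on succ {u \<in> Z. fst u = j}"
      using permutes_inj[OF succ_permutes] by (auto intro: inj_on_subset)
    show "succ ` {u \<in> Z. fst u = j} \<subseteq> {u \<in> Z. fst u = (j + 1) mod 3}"
    proof
      fix w assume "w \<in> succ ` {u \<in> Z. fst u = j}"
      then obtain u where u: "u \<in> Z" "fst u = j" "w = succ u" by blast
      then have "succ u \<in> Z" "fst (succ u) = (j + 1) mod 3"
        using cyclic_on_inI[OF assms(1)] assms(2) by (auto simp: succ_def)
      with u show "w \<in> {u \<in> Z. fst u = (j + 1) mod 3}" by simp
    qed
    show "finite {u \<in> Z. fst u = (j + 1) mod 3}"
      using fin by simp
  qed
  have "?c 0 \<le> ?c 1" "?c 1 \<le> ?c 2" "?c 2 \<le> ?c 0"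
    using step[of 0] step[of 1] step[of 2] by (simp_all add: numeral_2_eq_2)
  then have eq: "?c 0 = ?c 1" "?c 1 = ?c 2"
    by linarith+
  have "Z = {u \<in> Z. fst u = 0} \<union> ({u \<in> Z. fst u = 1} \<union> {u \<in> Z. fst u = 2})"
    using assms(2) by (auto simp: nodes_def)
  also have "card \<dots> = ?c 0 + (?c 1 + ?c 2)"
    using fin by (subst card_Un_disjoint; (subst card_Un_disjoint)?) auto
  finally have "card Z = 3 * ?c 0"
    using eq by simp
  moreover have "j = 0 \<or> j = 1 \<or> j = 2"
    using assms(3) by auto
  ultimately show ?thesis
    using eq by auto
qed

section \<open>Growth of the triple intersection\<close>

definition meet_dim :: "(nat \<Rightarrow> nat) \<Rightarrow> nat" where
  "meet_dim s = dim (\<Inter>k\<in>{..<3}. V k (s k))"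

text \<open>Raising one flag by a level adds at most one dimension, and none if some other flag
  \<open>k\<close> is still below the partner of \<open>x\<close>: then
  \<open>V j x \<inter> V k (s k)\<close> already lies in \<open>V j (x - 1)\<close>.\<close>

lemma meet_dim_step:
  assumes "\<forall>k<3. s k \<le> d" "j < 3" "x \<in> {1..d}"
  shows "meet_dim (s(j := x)) \<le> meet_dim (s(j := x - 1)) +
    (if \<forall>k<3. k \<noteq> j \<longrightarrow> partner j k x \<le> s k then 1 else 0)"
proof -
  define W where "W = (\<Inter>k\<in>{..<3} - {j}. V k (s k))"
  have W: "subspace W"
    unfolding W_def using assms(1)
    by (intro subspace_Inter) (auto intro!: complete_flag_subspace flag simp: d_eq[symmetric])
  have "(\<Inter>k\<in>{..<3}. V k ((s(j := y)) k)) = V j y \<inter> W" for y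
    using assms(2) unfolding W_def by (auto split: if_splits)
  then have meet: "meet_dim (s(j := y)) = dim (V j y \<inter> W)" for y
    by (simp add: meet_dim_def)
  show ?thesis
  proof (cases "\<forall>k<3. k \<noteq> j \<longrightarrow> partner j k x \<le> s k")
    case True
    then show ?thesis
      using dim_Int_step[OF flag[OF assms(2)] assms(3)[unfolded d_eq] W] True by (simp add: meet)
  next
    case False
    then obtain k where k: "k < 3" "k \<noteq> j" "\<not> partner j k x \<le> s k" by blast
    have "V j x \<inter> V k (s k) \<subseteq> V j (x - 1)"
      using match_le(2)[OF flag flag assms(3)[unfolded d_eq], of j k "s k"] k assms(1,2) d_eq
      by (simp add: partner_def)
    then have "V j x \<inter> W \<subseteq> V j (x - 1) \<inter> W"
      using k by (auto simp: W_def)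
    then have "dim (V j x \<inter> W) \<le> dim (V j (x - 1) \<inter> W)"
      by (rule dim_subset)
    then show ?thesis using False by (simp only: meet if_False)
  qed
qed

lemma meet_dim_stage:
  assumes "\<forall>k<3. s k \<le> d" "j < 3" "x \<le> y" "y \<le> d"
  shows "meet_dim (s(j := y)) \<le> meet_dim (s(j := x)) +
    card {z \<in> {x<..y}. \<forall>k<3. k \<noteq> j \<longrightarrow> partner j k z \<le> s k}"
  using assms(3,4)
proof (induction y rule: dec_induct)
  case base
  show ?case by simp
next
  case (step n)
  let ?P = "\<lambda>z. \<forall>k<3. k \<noteq> j \<longrightarrow> partner j k z \<le> s k"
  have "{z \<in> {x<..Suc n}. ?P z} = {z \<in> {x<..n}. ?P z} \<union> (if ?P (Suc n) then {Suc n} else {})"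
    using step.hyps by (auto simp: le_Suc_eq)
  then have "card {z \<in> {x<..Suc n}. ?P z} = card {z \<in> {x<..n}. ?P z} + (if ?P (Suc n) then 1 else 0)"
    by auto
  moreover have "meet_dim (s(j := Suc n)) \<le> meet_dim (s(j := n)) + (if ?P (Suc n) then 1 else 0)"
    using meet_dim_step[OF assms(1,2), of "Suc n"] step.prems by simp
  moreover have "meet_dim (s(j := n)) \<le> meet_dim (s(j := x)) + card {z \<in> {x<..n}. ?P z}"
    by (rule step.IH[OF Suc_leD[OF step.prems]])
  ultimately show ?case
    by linarith
qed

definition corner :: "nat \<Rightarrow> nat \<Rightarrow> nat" where
  "corner i j = (if j = 0 then i else partner 0 j i)"

text \<open>The other two corners are the partners of level \<open>i\<close> of flag 0. Only if
  these match each other as well is this a cycle of \<open>succ\<close>.\<close>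

definition triangle :: "nat \<Rightarrow> (nat \<times> nat) set" where
  "triangle i = (\<lambda>j. (j, corner i j)) ` {..<3}"

lemma corner_range: "i \<in> {1..d} \<Longrightarrow> j < 3 \<Longrightarrow> corner i j \<in> {1..d}"
  using partner_range[of 0 j i] by (auto simp: corner_def)

end

section \<open>Chains of triangles without a common vector\<close>

locale triangle_chain = three_flags V d
  for V :: "nat \<Rightarrow> nat \<Rightarrow> (real ^ 'n) set" and d +
  fixes I :: "nat set"
  assumes I_range: "I \<subseteq> {1..d}"
    and closed: "i \<in> I \<Longrightarrow> j < 3 \<Longrightarrow> k < 3 \<Longrightarrow> j \<noteq> k \<Longrightarrow> partner j k (corner i j) = corner i k"
    and increasing: "i \<in> I \<Longrightarrow> i' \<in> I \<Longrightarrow> i < i' \<Longrightarrow> j < 3 \<Longrightarrow> corner i j < corner i' j"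
    and bad: "i \<in> I \<Longrightarrow> \<nexists>v. \<forall>u\<in>triangle i. hits v u"
begin

text \<open>The keys order the nodes along a lattice path of triples of levels: between consecutive
  triangles of the chain first flag 0 is raised, then flag 1, then flag 2. The dimension of the
  triple intersection grows along this path only at peaks, and there by at most 1.\<close>

definition key :: "nat \<times> nat \<Rightarrow> nat" where
  "key u = 3 * card {i \<in> I. corner i (fst u) < snd u} + fst u"

text \<open>The two partners of a node are its neighbours on its cycle, so these are the local
  maxima of \<open>key\<close> along cycles. The triangles of the chain are left out because no
  dimension is gained there.\<close>

definition peaks :: "(nat \<times> nat) set" where
  "peaks = {u \<in> nodes. u \<notin> \<Union>(triangle ` I) \<and>
     (\<forall>k<3. k \<noteq> fst u \<longrightarrow> key (k, partner (fst u) k (snd u)) < key u)}"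

lemma finite_I: "finite I"
  using I_range finite_subset by blast

lemma finite_peaks: "finite peaks"
  using finite_nodes by (simp add: peaks_def)

text \<open>The corners of the triangles, with sentinels \<open>0\<close> and \<open>d + 1\<close> added to the chain.\<close>

definition bound :: "nat \<Rightarrow> nat \<Rightarrow> nat" where
  "bound i j = (if i = 0 then 0 else if i = d + 1 then d + 1 else corner i j)"

lemma bound_I: "i \<in> I \<Longrightarrow> bound i j = corner i j"
  using I_range by (force simp: bound_def)

lemma bound_less:
  assumes "p \<in> insert 0 I" "i \<in> insert (d + 1) I" "p < i" "j < 3"
  shows "bound p j < bound i j"
  using assms increasing[of p i j] corner_range[of p j] corner_range[of i j] I_range
  by (auto simp: bound_def split: if_splits)

text \<open>A vector of the triple intersection misses one of the three levels, since none hits the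
  whole triangle; the matching of the corners then makes it miss the others. So all three levels can
  be raised at once without gaining a dimension.\<close>

lemma meet_dim_triangle:
  assumes "i \<in> I"
  shows "meet_dim (corner i) \<le> meet_dim (\<lambda>j. corner i j - 1)"
  unfolding meet_dim_def
proof (intro dim_subset subsetI)
  fix v assume v: "v \<in> (\<Inter>k\<in>{..<3}. V k (corner i k))"
  have range: "corner i k \<in> {1..d}" if "k < 3" for k
    using corner_range that assms I_range by blast
  obtain j where j: "j < 3" "v \<in> V j (corner i j - 1)"
    using bad[OF assms] v by (auto simp: triangle_def hits_def at_level_def)
  show "v \<in> (\<Inter>k\<in>{..<3}. V k (corner i k - 1))"
  proof
    fix k :: nat assume "k \<in> {..<3}"
    then have k: "k < 3" by simp
    show "v \<in> V k (corner i k - 1)"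
    proof (cases "k = j")
      case False
      have "\<not> match (V k) (V j) (corner i k) \<le> corner i j - 1"
        using closed[OF assms k j(1) False] range[OF j(1)] by (auto simp: partner_def)
      moreover have "corner i j - 1 \<le> CARD('n)"
        using range[OF j(1)] by (auto simp: d_eq)
      ultimately have "V k (corner i k) \<inter> V j (corner i j - 1) \<subseteq> V k (corner i k - 1)"
        using match_le(2)[OF flag flag range[OF k, unfolded d_eq], OF k j(1)] by blast
      with v j k show ?thesis by blast
    qed (use j in simp)
  qed
qed

lemma meet_dim_zero: "meet_dim (\<lambda>j. 0) = 0"
proof -
  have "(\<Inter>k\<in>{..<3}. V k 0) \<subseteq> {0}"
    using complete_flag_0[OF flag[of 0]] by auto
  then have "meet_dim (\<lambda>j. 0) \<le> dim {0 :: real ^ 'n}"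
    unfolding meet_dim_def by (rule dim_subset)
  then show ?thesis by simp
qed

text \<open>When level \<open>z\<close> of flag \<open>j\<close> is added between consecutive
  triangles \<open>p\<close> and \<open>i\<close>, earlier flags stand just below \<open>i\<close>
  and later ones still at \<open>p\<close>. A partner already reached at that moment has a smaller
  key.\<close>

lemma gap_peak:
  assumes p: "p \<in> insert 0 I" and i: "i \<in> insert (d + 1) I" and pi: "p < i"
    and gap: "\<And>i'. i' \<in> I \<Longrightarrow> i' < i \<Longrightarrow> i' \<le> p"
    and j: "j < 3" and z: "bound p j < z" "z < bound i j"
    and low: "\<And>k. k < j \<Longrightarrow> partner j k z < bound i k"
    and high: "\<And>k. k < 3 \<Longrightarrow> j < k \<Longrightarrow> partner j k z \<le> bound p k"
  shows "(j, z) \<in> peaks"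
proof -
  have le_p: "corner i' k \<le> bound p k" if "i' \<in> I" "i' \<le> p" "k < 3" for i' k
    using that p increasing[of i' p k] I_range by (cases "i' = p") (auto simp: bound_I)
  have ge_i: "bound i k \<le> corner i' k" if "i' \<in> I" "i \<le> i'" "k < 3" for i' k
    using that i increasing[of i i' k] I_range by (cases "i' = i") (auto simp: bound_I)
  have "bound i j \<le> d + 1"
    using i corner_range[of i j] I_range j by (auto simp: bound_def)
  then have zr: "z \<in> {1..d}"
    using z by auto
  have off: "z \<noteq> corner i' j" if "i' \<in> I" for i'
    using le_p[OF that _ j] ge_i[OF that _ j] gap[OF that] z by (cases "i' < i") force+
  have below: "{i' \<in> I. corner i' j < z} = {i' \<in> I. i' \<le> p}"
    using le_p[OF _ _ j] ge_i[OF _ _ j] gap z pi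
    by (intro Collect_cong) (meson leI le_less_trans less_le_trans not_less_iff_gr_or_eq)
  have "key (k, partner j k z) < key (j, z)" if k: "k < 3" "k \<noteq> j" for k
  proof (cases "k < j")
    case True
    have "{i' \<in> I. corner i' k < partner j k z} \<subseteq> {i' \<in> I. i' \<le> p}"
      using low[OF True] ge_i[OF _ _ k(1)] gap by (force simp: not_less)
    then have "card {i' \<in> I. corner i' k < partner j k z} \<le> card {i' \<in> I. i' \<le> p}"
      using finite_I by (intro card_mono) auto
    with True show ?thesis by (simp add: key_def below)
  next
    case False
    then have jk: "j < k" using k by simp
    have h: "partner j k z \<le> bound p k"
      using high[OF k(1) jk] .
    have pos: "partner j k z \<ge> 1"
      using partner_range[OF j k(1) zr] by simp
    \<comment> \<open>The sentinel \<open>p = 0\<close> has bound \<open>0\<close>, which is below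
      every level.\<close>
    have pI: "p \<in> I"
      using p h pos by (auto simp: bound_def)
    have "i' < p" if "i' \<in> I" "corner i' k < partner j k z" for i'
      using increasing[of p i' k] that pI h bound_I[OF pI] k(1) by (cases i' p rule: linorder_cases) force+
    then have "{i' \<in> I. corner i' k < partner j k z} \<subseteq> {i' \<in> I. i' \<le> p} - {p}"
      by force
    then have "card {i' \<in> I. corner i' k < partner j k z} \<le> card ({i' \<in> I. i' \<le> p} - {p})"
      using finite_I by (intro card_mono) auto
    also have "\<dots> < card {i' \<in> I. i' \<le> p}"
      using finite_I pI by (intro card_Diff1_less) auto
    \<comment> \<open>Not counting \<open>p\<close> lowers the key by at least 3, more than the flag
      index can add back.\<close>
    finally show ?thesis
      using k(1) by (simp add: key_def below)
  qed
  moreover have "(j, z) \<notin> triangle i'" if "i' \<in> I" for i'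
    using off[OF that] by (auto simp: triangle_def)
  ultimately show ?thesis
    using j zr by (auto simp: peaks_def nodes_def)
qed

text \<open>Induction along the chain: from the preceding triangle \<open>p\<close>, or the
  sentinel, the three flags are raised in turn to just below \<open>i\<close>, and every dimension
  gained on the way is charged to its own peak.\<close>

lemma meet_dim_le_peaks:
  assumes "i \<in> insert (d + 1) I"
  shows "meet_dim (\<lambda>j. bound i j - 1) \<le> card {u \<in> peaks. snd u < bound i (fst u)}"
  using assms
proof (induction i rule: less_induct)
  case (less i)
  define P where "P = {i' \<in> insert 0 I. i' < i}"
  have i0: "i > 0" using less.prems I_range by auto
  have finP: "finite P" "P \<noteq> {}"
    using finite_I i0 by (auto simp: P_def)
  define p where "p = Max P"
  have "p \<in> P" using finP Max_in by (simp add: p_def)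
  then have p: "p \<in> insert 0 I" "p < i" by (auto simp: P_def)
  have gap: "i' \<le> p" if "i' \<in> I" "i' < i" for i'
    using finP that by (auto simp: p_def P_def intro: Max_ge)
  have lt: "bound p j < bound i j" if "j < 3" for j
    using bound_less[OF p(1) less.prems p(2) that] .
  have id: "bound i j \<le> d + 1" if "j < 3" for j
    using less.prems corner_range[of i j] I_range that by (auto simp: bound_def)
  let ?L = "{u \<in> peaks. snd u < bound p (fst u)}"
  \<comment> \<open>Before stage \<open>j\<close> the flags below \<open>j\<close> stand just below
    triangle \<open>i\<close>, the others still at \<open>p\<close>.\<close>
  define s where "s j k = (if k < j then bound i k - 1 else bound p k)" for j k
  define B where "B j = {z \<in> {bound p j<..bound i j - 1}. \<forall>k<3. k \<noteq> j \<longrightarrow> partner j k z \<le> s j k}" for j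
  have s_d: "s j k \<le> d" if "k < 3" for j k
    using lt[OF that] id[OF that] by (auto simp: s_def)
  have stage: "meet_dim (s (Suc j)) \<le> meet_dim (s j) + card (B j)" if "j < 3" for j
  proof -
    have "s (Suc j) = (s j)(j := bound i j - 1)" "s j = (s j)(j := bound p j)"
      by (auto simp: s_def fun_eq_iff)
    moreover have "meet_dim ((s j)(j := bound i j - 1)) \<le> meet_dim ((s j)(j := bound p j)) + card (B j)"
      unfolding B_def using that lt[OF that] id[OF that] s_d
      by (intro meet_dim_stage) auto
    ultimately show ?thesis by metis
  qed
  have "meet_dim (\<lambda>j. bound i j - 1) = meet_dim (s 3)"
    by (simp add: meet_dim_def s_def)
  also have "\<dots> \<le> meet_dim (s 0) + (card (B 0) + card (B 1) + card (B 2))"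
    using stage[of 0] stage[of 1] stage[of 2] by (simp add: numeral_3_eq_3 numeral_2_eq_2)
  also have "card (B 0) + card (B 1) + card (B 2) = (\<Sum>j<3. card (B j))"
    by (simp add: numeral_3_eq_3 numeral_2_eq_2)
  also have "\<dots> = card (SIGMA j:{..<3}. B j)"
    by (simp add: B_def)
  finally have 1: "meet_dim (\<lambda>j. bound i j - 1) \<le> meet_dim (s 0) + card (SIGMA j:{..<3}. B j)" .
  have "s 0 = bound p"
    by (simp add: s_def fun_eq_iff)
  \<comment> \<open>At the sentinel the intersection is zero; at a triangle the last step up to its
    corners is free.\<close>
  moreover have "meet_dim (bound p) \<le> card ?L"
  proof (cases "p = 0")
    case True
    then have "bound p = (\<lambda>j. 0)" by (simp add: bound_def fun_eq_iff)
    then show ?thesis using meet_dim_zero by simp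
  next
    case False
    then have pI: "p \<in> I" using p by simp
    then have b: "bound p = corner p" using bound_I by blast
    have "meet_dim (corner p) \<le> meet_dim (\<lambda>j. bound p j - 1)"
      using meet_dim_triangle[OF pI] b by simp
    also have "\<dots> \<le> card ?L"
      using less.IH[of p] p(2) pI by simp
    finally show ?thesis using b by simp
  qed
  ultimately have 2: "meet_dim (s 0) \<le> card ?L"
    by simp
  have "(j, z) \<in> peaks" if "j < 3" "z \<in> B j" for j z
  proof (rule gap_peak[OF p(1) less.prems p(2) gap that(1)])
    show "bound p j < z" "z < bound i j"
      using that by (auto simp: B_def)
    show "partner j k z < bound i k" if "k < j" for k
    proof -
      have "k < 3" "k \<noteq> j" using that \<open>j < 3\<close> by auto
      then have "partner j k z \<le> s j k" using \<open>z \<in> B j\<close> unfolding B_def by blast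
      moreover have "bound i k > 0" using lt[OF \<open>k < 3\<close>] by simp
      ultimately show ?thesis using that by (simp add: s_def)
    qed
    show "partner j k z \<le> bound p k" if "k < 3" "j < k" for k
    proof -
      have "k \<noteq> j" using that by simp
      then have "partner j k z \<le> s j k" using \<open>z \<in> B j\<close> that(1) unfolding B_def by blast
      then show ?thesis using that by (simp add: s_def)
    qed
  qed
  \<comment> \<open>Old peaks lie below \<open>bound p\<close> in their flag and the new ones above
    it, so the two counts add.\<close>
  then have "?L \<union> (SIGMA j:{..<3}. B j) \<subseteq> {u \<in> peaks. snd u < bound i (fst u)}"
    using lt by (auto simp: B_def peaks_def nodes_def intro: less_trans)
  then have "card (?L \<union> (SIGMA j:{..<3}. B j)) \<le> card {u \<in> peaks. snd u < bound i (fst u)}"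
    using finite_peaks by (intro card_mono) auto
  moreover have "card (?L \<union> (SIGMA j:{..<3}. B j)) = card ?L + card (SIGMA j:{..<3}. B j)"
    using finite_peaks by (intro card_Un_disjoint) (auto simp: B_def)
  ultimately show ?case
    using 1 2 by linarith
qed

text \<open>Just below the sentinel \<open>d + 1\<close> the path has reached the whole
  space.\<close>

lemma d_le_card_peaks: "d \<le> card peaks"
proof -
  have "(\<Inter>k\<in>{..<3}. V k d) = UNIV"
    using complete_flag_top[OF flag] by (simp add: d_eq)
  then have "meet_dim (\<lambda>j. d) = d"
    by (simp add: meet_dim_def d_eq)
  moreover have "meet_dim (\<lambda>j. d) \<le> card {u \<in> peaks. snd u < bound (d + 1) (fst u)}"
    using meet_dim_le_peaks[of "d + 1"] by (simp add: bound_def)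
  moreover have "\<dots> \<le> card peaks"
    using finite_peaks by (intro card_mono) auto
  ultimately show ?thesis by linarith
qed

text \<open>Being partners is mutual, so of two neighbouring peaks each would have the smaller
  key.\<close>

lemma peaks_succ:
  assumes "u \<in> peaks"
  shows "key (succ u) < key u" "succ u \<notin> peaks"
proof -
  obtain j x where u: "u = (j, x)" "j < 3" "x \<in> {1..d}" "u \<in> nodes"
    using assms by (auto simp: peaks_def nodes_def)
  define k where "k = (j + 1) mod 3"
  have k: "k < 3" "k \<noteq> j" using u(2) by (auto simp: k_def) presburger
  have su: "succ (j, x) = (k, partner j k x)"
    using u by (simp add: succ_def k_def)
  show lt: "key (succ u) < key u"
    using assms k unfolding u(1) by (simp add: peaks_def su)
  show "succ u \<notin> peaks"
  proof
    assume "succ u \<in> peaks"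
    then have "key (j, partner k j (partner j k x)) < key (succ u)"
      using u(1,2) k by (auto simp: peaks_def su)
    then show False
      using lt partner_inverse[OF u(2) k(1) u(3)] u(1) by simp
  qed
qed

lemma card_peaks_cycle:
  assumes "cyclic_on succ Z" "Z \<subseteq> nodes"
  shows "2 * card (peaks \<inter> Z) \<le> card Z"
proof -
  have fin: "finite Z"
    using assms(2) finite_nodes finite_subset by blast
  have "card (succ ` (peaks \<inter> Z)) = card (peaks \<inter> Z)"
    using permutes_inj[OF succ_permutes] by (intro card_image) (auto intro: inj_on_subset)
  moreover have "succ ` (peaks \<inter> Z) \<subseteq> Z - peaks"
    using cyclic_on_inI[OF assms(1)] peaks_succ(2) by auto
  ultimately have "card (peaks \<inter> Z) \<le> card (Z - peaks)"
    using fin by (metis card_mono finite_Diff)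
  moreover have "card Z = card (peaks \<inter> Z) + card (Z - peaks)"
    using fin by (metis Int_commute card_Int_Diff)
  ultimately show ?thesis by linarith
qed

end

section \<open>Unlinked cycles and the count for three flags\<close>

context three_flags
begin

text \<open>One equation closes the triangle; the remaining relations are inverses of the partner
  maps involved.\<close>

lemma closed_triangle:
  assumes "i \<in> {1..d}" "partner 1 2 (partner 0 1 i) = partner 0 2 i"
    and "j < 3" "k < 3" "j \<noteq> k"
  shows "partner j k (corner i j) = corner i k"
proof -
  have inv: "partner 1 0 (partner 0 1 i) = i" "partner 2 0 (partner 0 2 i) = i"
    "partner 2 1 (partner 1 2 (partner 0 1 i)) = partner 0 1 i"
    using assms(1) partner_range[of 0 1 i] by (auto intro!: partner_inverse)
  have "j = 0 \<or> j = 1 \<or> j = 2" "k = 0 \<or> k = 1 \<or> k = 2"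
    using assms by auto
  then show ?thesis
    using assms(2,5) inv by (auto simp: corner_def)
qed

text \<open>A cycle of length 3 has one node in each flag, so three steps from \<open>(0, i)\<close>
  lead back to it; this is the closing equation.\<close>

lemma triangle_cycle:
  assumes "cyclic_on succ Z" "Z \<subseteq> nodes" "card Z = 3"
  obtains i where "i \<in> {1..d}" "Z = triangle i" "partner 1 2 (partner 0 1 i) = partner 0 2 i"
proof -
  have "card {u \<in> Z. fst u = 0} = 1"
    using card_cycle_layer[OF assms(1,2), of 0] assms(3) by simp
  then obtain u where u: "{u \<in> Z. fst u = 0} = {u}"
    by (auto simp: card_1_singleton_iff)
  then have "u \<in> {u \<in> Z. fst u = 0}" by simp
  then obtain i where i: "u = (0, i)" by (cases u) simp
  have only: "i' = i" if "(0, i') \<in> Z" for i'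
  proof -
    have "(0, i') \<in> {u \<in> Z. fst u = 0}" using that by simp
    then show ?thesis unfolding u i by simp
  qed
  have Z0: "(0, i) \<in> Z" using u i by blast
  then have r0: "i \<in> {1..d}" using assms(2) by (auto simp: nodes_def)
  define y where "y = partner 0 1 i"
  define z where "z = partner 1 2 y"
  have r1: "y \<in> {1..d}" using partner_range[of 0 1 i] r0 by (simp add: y_def)
  have r2: "z \<in> {1..d}" using partner_range[of 1 2 y] r1 by (simp add: z_def)
  have "succ (0, i) = (1, y)" "succ (1, y) = (2, z)" "succ (2, z) = (0, partner 2 0 z)"
    using r0 r1 r2 by (simp_all add: succ_def nodes_def y_def z_def numeral_2_eq_2)
  then have Z: "(1, y) \<in> Z" "(2, z) \<in> Z" "(0, partner 2 0 z) \<in> Z"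
    using cyclic_on_inI[OF assms(1)] Z0 by metis+
  then have "partner 2 0 z = i" using only by blast
  then have closed: "z = partner 0 2 i"
    using partner_inverse[of 2 0 z] r2 by simp
  have "triangle i = {(0, i), (1, y), (2, z)}"
    by (auto simp: triangle_def corner_def y_def closed numeral_3_eq_3 numeral_2_eq_2 lessThan_Suc)
  moreover have "{(0, i), (1, y), (2, z)} = Z"
    using Z Z0 assms(3) by (intro card_subset_eq card_ge_0_finite) auto
  ultimately show ?thesis
    using that[of i] r0 closed by (simp add: y_def z_def)
qed

text \<open>If the two matched pairs of levels crossed, the larger of the two levels in flag
  \<open>j\<close> and the larger in flag \<open>k\<close> would satisfy the criterion
  \<open>linkedI\<close>.\<close>

lemma unlinked_not_crossing:
  assumes i: "i \<in> {1..d}" and closed: "partner j k (corner i j) = corner i k"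
    and jk: "j < 3" "k < 3" and x: "x \<in> {1..d}" "x \<noteq> corner i j"
    and unlinked: "\<not> linked (j, x) (k, corner i k)" "\<not> linked (j, corner i j) (k, partner j k x)"
  shows "x < corner i j \<longleftrightarrow> partner j k x < corner i k"
proof -
  let ?y = "partner j k x"
  have r: "corner i j \<in> {1..d}" "corner i k \<in> {1..d}" "?y \<in> {1..d}"
    using corner_range[OF i] partner_range[OF jk x(1)] jk by auto
  have inv: "partner k j ?y = x" "partner k j (corner i k) = corner i j"
    using partner_inverse[OF jk x(1)] partner_inverse[OF jk r(1)] closed by auto
  have "?y \<noteq> corner i k"
    using inv x by metis
  moreover have False if "x < corner i j" "corner i k < ?y"
    using linkedI[OF jk r(1,3)] that unlinked(2) closed inv by simp
  moreover have False if "corner i j < x" "?y < corner i k"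
    using linkedI[OF jk x(1) r(2)] that unlinked(1) closed inv by simp
  ultimately show ?thesis
    using x(2) by (meson linorder_neqE_nat)
qed

text \<open>Linked pairs are removed greedily and covered along a joint path; what survives in
  \<open>Y\<close> is pairwise unlinked.\<close>

lemma merge_linked_cycles:
  assumes "finite X" "\<forall>Z\<in>X. cyclic_on succ Z \<and> Z \<subseteq> nodes \<and> odd (card Z)"
  shows "\<exists>Y n. Y \<subseteq> X \<and> coverable (\<Union>(X - Y)) n \<and> 2 * n \<le> (\<Sum>Z\<in>X - Y. card Z) \<and>
    (\<forall>Z\<in>Y. \<forall>Z'\<in>Y. Z \<noteq> Z' \<longrightarrow> (\<forall>u\<in>Z. \<forall>w\<in>Z'. \<not> linked u w))"
  using assms
proof (induction X rule: finite_psubset_induct)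
  case (psubset X)
  show ?case
  proof (cases "\<forall>Z\<in>X. \<forall>Z'\<in>X. Z \<noteq> Z' \<longrightarrow> (\<forall>u\<in>Z. \<forall>w\<in>Z'. \<not> linked u w)")
    case True
    moreover have "coverable {} 0" by (auto simp: coverable_def intro: exI[of _ "{}"])
    ultimately show ?thesis by (intro exI[of _ X] exI[of _ 0]) simp
  next
    case False
    then obtain Z Z' u w where Z: "Z \<in> X" "Z' \<in> X" "Z \<noteq> Z'" "u \<in> Z" "w \<in> Z'" "linked u w"
      by blast
    let ?X = "X - {Z, Z'}"
    have sub: "?X \<subset> X" using Z by blast
    have odd: "\<forall>Z\<in>?X. cyclic_on succ Z \<and> Z \<subseteq> nodes \<and> odd (card Z)"
      using psubset.prems by blast
    from psubset.IH[OF sub odd] obtain Y n where Y: "Y \<subseteq> ?X" "coverable (\<Union>(?X - Y)) n"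
      "2 * n \<le> (\<Sum>Z\<in>?X - Y. card Z)"
      "\<forall>Z\<in>Y. \<forall>Z'\<in>Y. Z \<noteq> Z' \<longrightarrow> (\<forall>u\<in>Z. \<forall>w\<in>Z'. \<not> linked u w)"
      by (elim exE conjE) (rule that)
    have split: "X - Y = insert Z (insert Z' (?X - Y))"
      using Y(1) Z by blast
    have "coverable (Z \<union> Z') ((card Z + card Z' + 1) div 2)"
      using psubset.prems Z by (intro coverable_linked_cycles) auto
    from coverable_Un[OF this Y(2)]
    have "coverable (\<Union>(X - Y)) ((card Z + card Z' + 1) div 2 + n)"
      unfolding split by (simp add: Un_assoc)
    moreover have "(\<Sum>Z\<in>X - Y. card Z) = card Z + (card Z' + (\<Sum>Z\<in>?X - Y. card Z))"
      unfolding split using psubset.hyps Z by (simp add: sum.insert)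
    \<comment> \<open>Two odd sizes have an even sum, so the joint path costs exactly half its
      nodes, without rounding.\<close>
    moreover have "even (card Z + card Z')"
      using psubset.prems Z by simp
    ultimately have "coverable (\<Union>(X - Y)) ((card Z + card Z' + 1) div 2 + n) \<and>
        2 * ((card Z + card Z' + 1) div 2 + n) \<le> (\<Sum>Z\<in>X - Y. card Z)"
      using Y(3) by (auto elim!: evenE)
    moreover have "Y \<subseteq> X" using Y(1) by blast
    ultimately show ?thesis
      using Y(4) by blast
  qed
qed

text \<open>A cycle with a common vector costs one, an even cycle half its size, and linked odd
  cycles are merged. The rest, \<open>Y\<close>, is odd and pairwise unlinked, so its triangles form
  a chain and the peak count applies. Peaks pay for the rounding: three times the cost plus the
  number of peaks is at most twice the number of nodes.\<close>

lemma coverable_nodes: "coverable nodes (5 * d div 3)"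
proof -
  obtain C where C: "\<forall>Z\<in>C. cyclic_on succ Z" "\<Union>C = nodes"
    "\<forall>Z\<in>C. \<forall>Z'\<in>C. Z \<noteq> Z' \<longrightarrow> Z \<inter> Z' = {}"
    using permutes_decompose[OF succ_permutes finite_nodes] by (elim exE conjE) (rule that)
  have Csub: "Z \<subseteq> nodes" if "Z \<in> C" for Z using that C(2) by blast
  have finC: "finite C"
    using C(2) finite_nodes by (metis finite_UnionD)
  have finZ: "finite Z" if "Z \<in> C" for Z
    using Csub[OF that] finite_nodes finite_subset by blast
  define good where "good Z \<longleftrightarrow> (\<exists>v. \<forall>u\<in>Z. hits v u)" for Z
  define X where "X = {Z \<in> C. odd (card Z) \<and> \<not> good Z}"
  have "finite X" "\<forall>Z\<in>X. cyclic_on succ Z \<and> Z \<subseteq> nodes \<and> odd (card Z)"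
    using finC C(1) Csub by (auto simp: X_def)
  from merge_linked_cycles[OF this] obtain Y n where Y: "Y \<subseteq> X" "coverable (\<Union>(X - Y)) n"
      "2 * n \<le> (\<Sum>Z\<in>X - Y. card Z)"
    and unlinked: "\<And>Z Z' u w. Z \<in> Y \<Longrightarrow> Z' \<in> Y \<Longrightarrow> Z \<noteq> Z' \<Longrightarrow> u \<in> Z \<Longrightarrow> w \<in> Z' \<Longrightarrow> \<not> linked u w"
    by metis
  have YC: "Y \<subseteq> C" using Y(1) by (auto simp: X_def)
  define I where "I = {i \<in> {1..d}. triangle i \<in> Y \<and> partner 1 2 (partner 0 1 i) = partner 0 2 i}"
  have I_Y: "triangle i \<in> Y" "i \<in> {1..d}" "partner 1 2 (partner 0 1 i) = partner 0 2 i" if "i \<in> I" for i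
    using that by (auto simp: I_def)
  have corner_in: "(j, corner i j) \<in> triangle i" if "j < 3" for i j
    using that by (auto simp: triangle_def)
  have not_corner: "x \<noteq> corner i j" if "i \<in> I" "(j, x) \<in> Z" "Z \<in> C" "Z \<noteq> triangle i" "j < 3" for i j x Z
    using C(3) I_Y(1)[OF that(1)] YC that corner_in[OF that(5), of i] by blast
  have unlinked_I: "\<not> linked (a, corner i a) (b, corner i' b)"
    if "i \<in> I" "i' \<in> I" "triangle i \<noteq> triangle i'" "a < 3" "b < 3" for i i' a b
    using unlinked[OF I_Y(1)[OF that(1)] I_Y(1)[OF that(2)] that(3) corner_in[OF that(4)] corner_in[OF that(5)]] .
  interpret triangle_chain V d I
  proof
    show "I \<subseteq> {1..d}" by (auto simp: I_def)
    show closed: "partner j k (corner i j) = corner i k" if "i \<in> I" "j < 3" "k < 3" "j \<noteq> k" for i j k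
      using that I_Y by (intro closed_triangle) auto
    \<comment> \<open>Distinct triangles in \<open>Y\<close> are unlinked, hence do not cross
      between flags \<open>0\<close> and \<open>j\<close>.\<close>
    show "corner i j < corner i' j" if "i \<in> I" "i' \<in> I" "i < i'" "j < 3" for i i' j
    proof (cases "j = 0")
      case True
      then show ?thesis using that by (simp add: corner_def)
    next
      case False
      have c0: "corner i 0 = i" "corner i' 0 = i'" and cj: "corner i j = partner 0 j i"
        using False by (simp_all add: corner_def)
      have ne: "triangle i \<noteq> triangle i'"
      proof
        assume "triangle i = triangle i'"
        then have "(0, corner i 0) \<in> triangle i'" using corner_in[of 0 i] by simp
        then show False using that(3) c0 by (auto simp: triangle_def)
      qed
      have "i < corner i' 0 \<longleftrightarrow> partner 0 j i < corner i' j"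
      proof (rule unlinked_not_crossing)
        show "\<not> linked (0, i) (j, corner i' j)"
          using unlinked_I[OF that(1,2) ne _ that(4), of 0] c0 by simp
        show "\<not> linked (0, corner i' 0) (j, partner 0 j i)"
          using unlinked_I[OF that(2,1) ne[symmetric] _ that(4), of 0] cj by simp
        show "partner 0 j (corner i' 0) = corner i' j"
          using False by (simp add: corner_def)
      qed (use that I_Y c0 in auto)
      then show ?thesis using that c0 cj by simp
    qed
    show "\<nexists>v. \<forall>u\<in>triangle i. hits v u" if "i \<in> I" for i
      using I_Y(1)[OF that] Y(1) by (auto simp: X_def good_def)
  qed
  \<comment> \<open>Every cycle of length 3 in \<open>Y\<close> belongs to the chain, and
    \<open>peaks\<close> excludes it.\<close>
  have peaks_triangle: "peaks \<inter> Z = {}" if ZY: "Z \<in> Y" and card3: "card Z = 3" for Z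
  proof -
    have "Z \<in> C" using ZY YC by blast
    then obtain i where "i \<in> {1..d}" "Z = triangle i" "partner 1 2 (partner 0 1 i) = partner 0 2 i"
      using triangle_cycle[OF _ Csub card3] C(1) by metis
    then have "i \<in> I" "Z = triangle i" using ZY by (simp_all add: I_def)
    then show ?thesis by (auto simp: peaks_def)
  qed
  \<comment> \<open>A longer cycle in \<open>Y\<close> crosses no triangle of the chain. Passing
    from flag \<open>j\<close> to \<open>j + 1\<close> therefore keeps the count in
    \<open>key\<close> and raises the key by 1, so a peak can only be in flag 2.\<close>
  have peaks_long: "peaks \<inter> Z \<subseteq> {u \<in> Z. fst u = 2}" if ZY: "Z \<in> Y" and long: "card Z \<noteq> 3" for Z
  proof
    fix u assume u: "u \<in> peaks \<inter> Z"
    obtain j x where jx: "u = (j, x)" "j < 3" "x \<in> {1..d}" "u \<in> nodes"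
      using u by (auto simp: peaks_def nodes_def)
    have ZC: "Z \<in> C" using ZY YC by blast
    have cycZ: "cyclic_on succ Z" using ZC C(1) by blast
    have "j = 2"
    proof (rule ccontr)
      assume "j \<noteq> 2"
      then have j: "j < 2" "j + 1 < 3" "(j + 1) mod 3 = j + 1" using jx(2) by auto
      then have su: "succ u = (j + 1, partner j (j + 1) x)"
        using jx by (simp add: succ_def)
      have suZ: "succ u \<in> Z" using cyclic_on_inI[OF cycZ] u by blast
      have "corner i j < x \<longleftrightarrow> corner i (j + 1) < partner j (j + 1) x" if i: "i \<in> I" for i
      proof -
        have ne: "Z \<noteq> triangle i"
        proof
          assume "Z = triangle i"
          moreover have "card (triangle i) = 3"
            unfolding triangle_def by (subst card_image) (auto simp: inj_on_def)
          ultimately show False using long by simp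
        qed
        have 1: "x \<noteq> corner i j" "partner j (j + 1) x \<noteq> corner i (j + 1)"
          using not_corner[OF i _ ZC ne] u suZ jx j su by auto
        have "x < corner i j \<longleftrightarrow> partner j (j + 1) x < corner i (j + 1)"
        proof (rule unlinked_not_crossing)
          show "\<not> linked (j, x) (j + 1, corner i (j + 1))"
            using unlinked[OF ZY I_Y(1)[OF i] ne _ corner_in[OF j(2)]] u jx(1) by blast
          show "\<not> linked (j, corner i j) (j + 1, partner j (j + 1) x)"
            using unlinked[OF I_Y(1)[OF i] ZY ne[symmetric] corner_in[OF jx(2)]] suZ su by metis
          show "partner j (j + 1) (corner i j) = corner i (j + 1)"
            using closed[OF i jx(2) j(2)] by simp
        qed (use I_Y(2)[OF i] jx j 1 in auto)
        with 1 show ?thesis by linarith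
      qed
      then have "{i \<in> I. corner i j < x} = {i \<in> I. corner i (j + 1) < partner j (j + 1) x}"
        by blast
      then have "key (succ u) = key u + 1"
        unfolding su unfolding jx(1) by (simp add: key_def)
      then show False using peaks_succ(1)[of u] u by simp
    qed
    with u jx show "u \<in> {u \<in> Z. fst u = 2}" by simp
  qed
  define c where "c Z = (if good Z then 1 else (card Z + 1) div 2)" for Z
  have cov_c: "coverable Z (c Z)" if "Z \<in> C" for Z
  proof (cases "good Z")
    case True
    then show ?thesis using coverable_one by (auto simp: good_def c_def)
  next
    case False
    then show ?thesis using coverable_cycle[of Z] that C(1) Csub by (simp add: c_def)
  qed
  \<comment> \<open>Summed over all cycles, with \<open>card peaks \<ge> d\<close>, this gives \<open>3 * cost + d \<le> 6 * d\<close>.\<close>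
  have share: "3 * c Z + card (peaks \<inter> Z) \<le> 2 * card Z" if Z: "Z \<in> C - (X - Y)" for Z
  proof -
    have cyc: "cyclic_on succ Z" "Z \<subseteq> nodes" using Z C(1) Csub by auto
    have half: "2 * card (peaks \<inter> Z) \<le> card Z"
      by (rule card_peaks_cycle[OF cyc])
    define k where "k = card {u \<in> Z. fst u = 2}"
    have k: "card Z = 3 * k"
      using card_cycle_layer[OF cyc, of 2] by (simp add: k_def)
    have "Z \<noteq> {}" using cyc(1) by (auto simp: cyclic_on_def)
    then have k1: "k \<ge> 1" using k finZ Z by (cases k) auto
    consider "good Z" | "\<not> good Z" "even (card Z)" | "Z \<in> Y" "\<not> good Z" "card Z = 3"
      | "Z \<in> Y" "\<not> good Z" "odd (card Z)" "card Z \<noteq> 3"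
      using Z by (auto simp: X_def)
    then show ?thesis
    proof cases
      case 1
      then show ?thesis using half k k1 by (simp add: c_def)
    next
      case 2
      then show ?thesis using half by (auto simp: c_def elim!: evenE)
    next
      case 3
      \<comment> \<open>Equality: two vectors for three nodes, and no peak.\<close>
      then show ?thesis using peaks_triangle[of Z] by (simp add: c_def)
    next
      case 4
      have "card (peaks \<inter> Z) \<le> k"
        unfolding k_def using peaks_long[of Z] 4 finZ Z by (intro card_mono) auto
      \<comment> \<open>\<open>k\<close> is odd and not 1. With at most \<open>k\<close> peaks the
        claim is \<open>3 * (3 * k + 1) / 2 + k \<le> 6 * k\<close>, which is exactly
        \<open>k \<ge> 3\<close>.\<close>
      moreover have "k \<ge> 3" "2 * ((card Z + 1) div 2) = card Z + 1"
        using 4 k k1 by (auto elim!: oddE)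
      moreover have "c Z = (card Z + 1) div 2"
        using 4 by (simp add: c_def)
      ultimately show ?thesis using k by linarith
    qed
  qed
  define m where "m = n + (\<Sum>Z\<in>C - (X - Y). c Z)"
  have XYC: "X - Y \<subseteq> C" by (auto simp: X_def)
  have "nodes = \<Union>(X - Y) \<union> \<Union>(C - (X - Y))"
    using C(2) XYC by blast
  then have "coverable nodes m"
    unfolding m_def using coverable_Un[OF Y(2) coverable_Union[of "C - (X - Y)" c]] finC cov_c by simp
  moreover have "3 * m \<le> 5 * d"
  proof -
    have disj: "\<forall>Z\<in>C. \<forall>Z'\<in>C. Z \<noteq> Z' \<longrightarrow> (peaks \<inter> Z) \<inter> (peaks \<inter> Z') = {}"
      using C(3) by blast
    have "peaks = (\<Union>Z\<in>C. peaks \<inter> Z)"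
      using C(2) by (auto simp: peaks_def)
    then have "card peaks = card (\<Union>Z\<in>C. peaks \<inter> Z)" by simp
    also have "\<dots> = (\<Sum>Z\<in>C. card (peaks \<inter> Z))"
      using finC finite_peaks disj by (intro card_UN_disjoint) auto
    finally have peaks: "card peaks = (\<Sum>Z\<in>C. card (peaks \<inter> Z))" .
    have nodes: "3 * d = (\<Sum>Z\<in>C. card Z)"
    proof -
      have "card (\<Union>C) = (\<Sum>Z\<in>C. card Z)"
        using finZ C(3) by (intro card_Union_disjoint) (auto simp: pairwise_def disjnt_def)
      then show ?thesis using card_nodes C(2) by simp
    qed
    have split: "(\<Sum>Z\<in>C. g Z) = (\<Sum>Z\<in>C - (X - Y). g Z) + (\<Sum>Z\<in>X - Y. g Z)" for g :: "_ \<Rightarrow> nat"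
      by (rule sum.subset_diff[OF XYC finC])
    have "3 * (\<Sum>Z\<in>C - (X - Y). c Z) + (\<Sum>Z\<in>C - (X - Y). card (peaks \<inter> Z))
        = (\<Sum>Z\<in>C - (X - Y). 3 * c Z + card (peaks \<inter> Z))"
      by (simp add: sum.distrib sum_distrib_left)
    also have "\<dots> \<le> (\<Sum>Z\<in>C - (X - Y). 2 * card Z)"
      by (intro sum_mono share)
    also have "\<dots> = 2 * (\<Sum>Z\<in>C - (X - Y). card Z)"
      by (simp add: sum_distrib_left)
    finally have A: "3 * (\<Sum>Z\<in>C - (X - Y). c Z) + (\<Sum>Z\<in>C - (X - Y). card (peaks \<inter> Z))
        \<le> 2 * (\<Sum>Z\<in>C - (X - Y). card Z)" .
    have "2 * (\<Sum>Z\<in>X - Y. card (peaks \<inter> Z)) = (\<Sum>Z\<in>X - Y. 2 * card (peaks \<inter> Z))"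
      by (simp add: sum_distrib_left)
    also have "\<dots> \<le> (\<Sum>Z\<in>X - Y. card Z)"
      using XYC C(1) Csub by (intro sum_mono card_peaks_cycle) auto
    finally have B: "2 * (\<Sum>Z\<in>X - Y. card (peaks \<inter> Z)) \<le> (\<Sum>Z\<in>X - Y. card Z)" .
    \<comment> \<open>The merged cycles obey \<open>3 * n + p2 \<le> 2 * s2\<close> as well, since
      \<open>n\<close> and \<open>p2\<close> are each at most half of \<open>s2\<close>.\<close>
    have arith: "3 * (n + a) \<le> 5 * d"
      if "3 * a + p1 \<le> 2 * s1" "2 * p2 \<le> s2" "2 * n \<le> s2" "d \<le> p1 + p2" "3 * d = s1 + s2"
      for a p1 p2 s1 s2 :: nat
      using that by (simp add: algebra_simps)
    show ?thesis
      unfolding m_def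
      using d_le_card_peaks by (intro arith[OF A B Y(3)]) (simp_all only: peaks nodes split)
  qed
  ultimately show ?thesis
    by (auto intro: coverable_mono)
qed

end

section \<open>The maximum\<close>

lemma odd_ge_3E:
  fixes m :: nat
  assumes "odd m" "m \<noteq> 1"
  obtains q where "m = 2 * q + 3"
proof -
  from assms(1) obtain k where "m = 2 * k + 1" by (elim oddE)
  with assms(2) have "m = 2 * (k - 1) + 3" by (cases k) auto
  with that show ?thesis .
qed

section \<open>Generating sets of the claimed size\<close>

lemma two_flags_generated:
  fixes A B :: "nat \<Rightarrow> (real ^ 'n) set"
  assumes A: "complete_flag A" and B: "complete_flag B"
  shows "\<exists>S. finite S \<and> card S \<le> CARD('n) \<and> generates_flag S A \<and> generates_flag S B"
proof -
  let ?X = "{1..CARD('n)}"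
  have "\<forall>x\<in>?X. \<exists>v. at_level A x v \<and> at_level B (match A B x) v"
  proof
    fix x assume x: "x \<in> ?X"
    show "\<exists>v. at_level A x v \<and> at_level B (match A B x) v"
      using match_inverse[OF A B x] by (intro common_level_vector[OF A B x match_le(1)[OF A B x]]) auto
  qed
  from bchoice[OF this] obtain v
    where v: "\<forall>x\<in>?X. at_level A x (v x) \<and> at_level B (match A B x) (v x)"
    by blast
  have "generates_flag (v ` ?X) A"
    unfolding generates_flag_iff[OF A] using v by blast
  \<comment> \<open>Level \<open>y\<close> of \<open>B\<close> is served by the vector chosen for
    \<open>match B A y\<close>, as the two matchings are mutually inverse.\<close>
  moreover have "\<exists>w\<in>v ` ?X. at_level B y w" if "y \<in> ?X" for y
    using v[rule_format, OF match_le(1)[OF B A that]] match_le(1)[OF B A that]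
      match_inverse[OF B A that] by auto
  then have "generates_flag (v ` ?X) B"
    unfolding generates_flag_iff[OF B] by blast
  moreover have "card (v ` ?X) \<le> CARD('n)"
    using card_image_le[of ?X v] by simp
  ultimately show ?thesis by blast
qed

lemma three_flags_generated:
  fixes A B C :: "nat \<Rightarrow> (real ^ 'n) set"
  assumes A: "complete_flag A" and B: "complete_flag B" and C: "complete_flag C"
  shows "\<exists>S. finite S \<and> card S \<le> 5 * CARD('n) div 3 \<and>
    generates_flag S A \<and> generates_flag S B \<and> generates_flag S C"
proof -
  define V where "V j = (if j = 0 then A else if j = 1 then B else C)" for j :: nat
  interpret three_flags V "CARD('n)"
    using assms by unfold_locales (auto simp: V_def)
  obtain S where S: "finite S" "card S \<le> 5 * CARD('n) div 3"
    "\<forall>u\<in>nodes. \<exists>v\<in>S. hits v u"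
    using coverable_nodes unfolding coverable_def by (elim exE conjE) (rule that)
  have gen: "generates_flag S (V j)" if "j < 3" for j
    unfolding generates_flag_iff[OF flag[OF that]]
  proof
    fix x assume "x \<in> {1..CARD('n)}"
    with that have "(j, x) \<in> nodes" by (simp add: nodes_def)
    with S(3) show "\<exists>v\<in>S. at_level (V j) x v" by (force simp: hits_def)
  qed
  show ?thesis
    using S(1,2) gen[of 0] gen[of 1] gen[of 2] by (auto simp: V_def)
qed

text \<open>The flags are handled in pairs. The offset \<open>a\<close> allows the pairs to start
  after three flags that are treated separately.\<close>

lemma flags_generated_even:
  fixes U :: "nat \<Rightarrow> nat \<Rightarrow> (real ^ 'n) set"
  assumes "\<forall>j\<in>{1..2 * q}. complete_flag (U (a + j))"
  shows "\<exists>S. finite S \<and> card S \<le> q * CARD('n) \<and> (\<forall>j\<in>{1..2 * q}. generates_flag S (U (a + j)))"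
  using assms
proof (induction q)
  case 0
  show ?case by (intro exI[of _ "{}"]) simp
next
  case (Suc q)
  have "\<forall>j\<in>{1..2 * q}. complete_flag (U (a + j))"
    using Suc.prems by simp
  from Suc.IH[OF this] obtain S where S: "finite S" "card S \<le> q * CARD('n)"
    "\<forall>j\<in>{1..2 * q}. generates_flag S (U (a + j))"
    by (elim exE conjE) (rule that)
  have flags: "complete_flag (U (a + (2 * q + 1)))" "complete_flag (U (a + (2 * q + 2)))"
    using Suc.prems[rule_format, of "2 * q + 1"] Suc.prems[rule_format, of "2 * q + 2"] by simp_all
  obtain S' where S': "finite S'" "card S' \<le> CARD('n)"
    "generates_flag S' (U (a + (2 * q + 1)))" "generates_flag S' (U (a + (2 * q + 2)))"
    using two_flags_generated[OF flags] by blast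
  have mono: "generates_flag (S \<union> S') A" if "generates_flag S A \<or> generates_flag S' A" for A
    using that unfolding generates_flag_def by (meson le_supI1 le_supI2)
  have "generates_flag (S \<union> S') (U (a + j))" if j: "j \<in> {1..2 * Suc q}" for j
  proof -
    consider "j \<in> {1..2 * q}" | "j = 2 * q + 1" | "j = 2 * q + 2"
      using j by fastforce
    then show ?thesis using S(3) S'(3,4) mono by cases blast+
  qed
  moreover have "card (S \<union> S') \<le> Suc q * CARD('n)"
    using card_Un_le[of S S'] S(2) S'(2) by simp
  ultimately show ?case
    using S(1) S'(1) by (intro exI[of _ "S \<union> S'"]) auto
qed

text \<open>The claimed value in natural numbers. For odd \<open>m\<close> it reflects the
  construction, \<open>(m - 3) div 2\<close> pairs and one triple of flags.\<close>

definition flag_bound :: "nat \<Rightarrow> nat \<Rightarrow> nat" where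
  "flag_bound m d = (if m = 1 \<or> d = 1 then d else if even m then m * d div 2
     else (m - 3) div 2 * d + 5 * d div 3)"

lemma flags_generated:
  fixes U :: "nat \<Rightarrow> nat \<Rightarrow> (real ^ 'n) set"
  assumes U: "\<forall>j\<in>{1..m}. complete_flag (U j)" and m: "m \<ge> 1"
  shows "\<exists>S. finite S \<and> card S \<le> flag_bound m (CARD('n)) \<and> (\<forall>j\<in>{1..m}. generates_flag S (U j))"
proof -
  consider "m = 1" | "CARD('n) = 1" | "m \<noteq> 1" "CARD('n) \<noteq> 1" "even m"
    | "m \<noteq> 1" "CARD('n) \<noteq> 1" "odd m" by blast
  then show ?thesis
  proof cases
    case 1
    \<comment> \<open>A single flag is paired with itself.\<close>
    then show ?thesis
      using two_flags_generated[of "U 1" "U 1"] U by (auto simp: flag_bound_def)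
  next
    case 2
    \<comment> \<open>In dimension 1 any nonzero vector, here the all-ones vector, generates every
      flag.\<close>
    have "generates_flag {1 :: real ^ 'n} (U j)" if "j \<in> {1..m}" for j
    proof -
      have f: "complete_flag (U j)" using U that by blast
      have "(1 :: real ^ 'n) \<noteq> 0" by (simp add: vec_eq_iff)
      then have "at_level (U j) 1 (1 :: real ^ 'n)"
        using complete_flag_top[OF f] complete_flag_0[OF f] 2 by (simp add: at_level_def)
      then show ?thesis
        unfolding generates_flag_iff[OF f] using 2 by simp
    qed
    then show ?thesis
      using 2 by (intro exI[of _ "{1}"]) (auto simp: flag_bound_def)
  next
    case 3
    then obtain q where q: "m = 2 * q" by blast
    then show ?thesis
      using flags_generated_even[of q U 0] U 3 by (auto simp: flag_bound_def)
  next
    case 4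
    then obtain q where q: "m = 2 * q + 3"
      using odd_ge_3E by metis
    have f: "complete_flag (U 1)" "complete_flag (U 2)" "complete_flag (U 3)"
      using U q by auto
    obtain S where S: "finite S" "card S \<le> 5 * CARD('n) div 3"
      "generates_flag S (U 1)" "generates_flag S (U 2)" "generates_flag S (U 3)"
      using three_flags_generated[OF f] by blast
    obtain S' where S': "finite S'" "card S' \<le> q * CARD('n)"
      "\<forall>j\<in>{1..2 * q}. generates_flag S' (U (3 + j))"
      using flags_generated_even[of q U 3] U q by auto
    have mono: "generates_flag (S \<union> S') A" if "generates_flag S A \<or> generates_flag S' A" for A
      using that unfolding generates_flag_def by (meson le_supI1 le_supI2)
    have "generates_flag (S \<union> S') (U j)" if j: "j \<in> {1..m}" for j
    proof -
      consider "j = 1" | "j = 2" | "j = 3" | "j - 3 \<in> {1..2 * q}" "3 + (j - 3) = j"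
        using j q by fastforce
      then show ?thesis using S(3-5) S'(3) mono by cases metis+
    qed
    moreover have "card (S \<union> S') \<le> flag_bound m (CARD('n))"
      using card_Un_le[of S S'] S(2) S'(2) 4 q by (simp add: flag_bound_def)
    ultimately show ?thesis
      using S(1) S'(1) by (intro exI[of _ "S \<union> S'"]) auto
  qed
qed

section \<open>Flags attaining the bound\<close>

lemma card_ge_dim_if_generates:
  fixes A :: "nat \<Rightarrow> (real ^ 'n) set"
  assumes A: "complete_flag A" and "generates_flag S A" "finite S"
  shows "CARD('n) \<le> card S"
proof -
  obtain T where "T \<subseteq> S" "A (CARD('n)) = span T"
    using assms(2) unfolding generates_flag_def by blast
  then have "span S = UNIV"
    using complete_flag_top[OF A] span_mono[of T S] by auto
  then have "dim S = CARD('n)"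
    by (metis dim_UNIV dim_span DIM_cart DIM_real mult.right_neutral)
  then show ?thesis
    using dim_le_card'[OF assms(3)] by simp
qed

lemma flags_attaining_bound:
  assumes "m \<ge> 1"
  shows "\<exists>U :: nat \<Rightarrow> nat \<Rightarrow> (real ^ 'n) set. (\<forall>j. complete_flag (U j)) \<and>
    (\<forall>S. finite S \<longrightarrow> (\<forall>j\<in>{1..m}. generates_flag S (U j)) \<longrightarrow> flag_bound m (CARD('n)) \<le> card S)"
proof (cases "m = 1 \<or> CARD('n) = 1")
  case True
  obtain A :: "nat \<Rightarrow> (real ^ 'n) set" where A: "complete_flag A"
    using complete_flag_ex by blast
  have "flag_bound m (CARD('n)) = CARD('n)"
    using True by (simp add: flag_bound_def)
  moreover have "CARD('n) \<le> card S" if "finite S" "\<forall>j\<in>{1..m}. generates_flag S A" for S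
    using card_ge_dim_if_generates[OF A, of S] that assms by auto
  ultimately show ?thesis
    using A by (intro exI[of _ "\<lambda>j. A"]) auto
next
  case False
  define d where "d = CARD('n)"
  have "d > 0" "d \<noteq> 1" using False by (simp_all add: d_def)
  then have d2: "d \<ge> 2" by linarith
  \<comment> \<open>As many blocks of size 3 as possible: \<open>p\<close> is the least number for
    which 3 divides \<open>d - 2 * p\<close>. If \<open>d mod 3 = 1\<close>, then
    \<open>d \<ge> 2\<close> gives \<open>d \<ge> 4\<close>, enough room for two blocks of size
    2.\<close>
  define p where "p = (if d mod 3 = 0 then 0 else if d mod 3 = 1 then 2 else 1 :: nat)"
  define q where "q = (d - 2 * p) div 3"
  have pq: "2 * p + 3 * q = d"
    using d2 unfolding p_def q_def by (auto split: if_splits) presburger+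
  have "flag_bound m d \<le> p * m + q * ((3 * m + 1) div 2)"
  proof (cases "even m")
    case True
    then obtain k where "m = 2 * k" by blast
    then show ?thesis
      using pq False by (auto simp: flag_bound_def d_def[symmetric] algebra_simps)
  next
    case odd: False
    then obtain l where l: "m = 2 * l + 3"
      using False odd_ge_3E by metis
    have "p = 0 \<or> p = 1 \<or> p = 2" by (simp add: p_def)
    \<comment> \<open>This needs \<open>p\<close> to be at most 2, where
      \<open>10 * p div 3 = 3 * p\<close>.\<close>
    then have "5 * (2 * p + 3 * q) div 3 = p * 3 + q * 5" by auto
    then have "5 * d div 3 = p * 3 + q * 5" by (simp only: pq)
    then show ?thesis
      using l False odd d2 by (simp add: flag_bound_def flip: pq) (simp add: algebra_simps)
  qed
  moreover from flags_needing_many_vectors[OF pq[unfolded d_def], of m]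
  obtain U :: "nat \<Rightarrow> nat \<Rightarrow> (real ^ 'n) set" where U: "\<forall>j. complete_flag (U j)"
    and N: "\<forall>S. finite S \<longrightarrow> (\<forall>j\<in>{1..m}. generates_flag S (U j)) \<longrightarrow>
      p * m + q * ((3 * m + 1) div 2) \<le> card S"
    by (elim exE conjE) (rule that)
  ultimately have "\<forall>S. finite S \<longrightarrow> (\<forall>j\<in>{1..m}. generates_flag S (U j)) \<longrightarrow>
      flag_bound m (CARD('n)) \<le> card S"
    unfolding d_def using le_trans by blast
  with U show ?thesis by blast
qed

text \<open>The upper bound does double duty: it makes the \<open>LEAST\<close> attained and the set
  of values finite, so that \<open>Max\<close> is meaningful.\<close>

lemma mu_max_eq:
  assumes "m \<ge> 1"
  shows "mu_max m TYPE('n::finite) = flag_bound m (CARD('n))"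
proof -
  let ?N = "flag_bound m (CARD('n))"
  let ?P = "\<lambda>U :: nat \<Rightarrow> nat \<Rightarrow> (real ^ 'n) set. \<forall>j\<in>{1..m}. complete_flag (U j)"
  let ?G = "\<lambda>(U :: nat \<Rightarrow> nat \<Rightarrow> (real ^ 'n) set) k.
    \<exists>S. finite S \<and> card S = k \<and> (\<forall>j\<in>{1..m}. generates_flag S (U j))"
  have upper: "?G U (mu_flags m U) \<and> mu_flags m U \<le> ?N" if U: "?P U" for U
  proof -
    obtain k where k: "?G U k" "k \<le> ?N"
      using flags_generated[OF U assms] by blast
    have "?G U (mu_flags m U)"
      unfolding mu_flags_def by (rule LeastI[of "?G U", OF k(1)])
    moreover have "mu_flags m U \<le> k"
      unfolding mu_flags_def by (rule Least_le[of "?G U", OF k(1)])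
    ultimately show ?thesis using k(2) by simp
  qed
  obtain U :: "nat \<Rightarrow> nat \<Rightarrow> (real ^ 'n) set" where U: "\<forall>j. complete_flag (U j)"
    "\<forall>S. finite S \<longrightarrow> (\<forall>j\<in>{1..m}. generates_flag S (U j)) \<longrightarrow> ?N \<le> card S"
    using flags_attaining_bound[OF assms, where 'n = 'n] by blast
  have "mu_flags m U = ?N"
    using upper[of U] U by fastforce
  then have mem: "?N \<in> {mu_flags m U | U. ?P U}"
    using U(1) by (intro CollectI exI[of _ U]) simp
  have le: "k \<le> ?N" if "k \<in> {mu_flags m U | U. ?P U}" for k
    using that upper by blast
  then have "finite {mu_flags m U | U. ?P U}"
    by (meson finite_nat_set_iff_bounded_le)
  then show ?thesis
    unfolding mu_max_def using mem le by (intro Max_eqI) auto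
qed

theorem theorem1p1:
  fixes m d :: nat
  assumes "m \<ge> 1" and "d \<ge> 1" and "CARD('n::finite) = d"
  shows "(m = 1 \<or> d = 1 \<longrightarrow> real (mu_max m TYPE('n)) = real d) \<and>
         (m \<ge> 2 \<and> even m \<and> d \<ge> 2 \<longrightarrow>
            real (mu_max m TYPE('n)) = real m * real d / 2) \<and>
         (m \<ge> 3 \<and> odd m \<and> d \<ge> 2 \<longrightarrow>
            real (mu_max m TYPE('n)) =
              real m * real d / 2 + of_int \<lfloor>2 * real d / 3\<rfloor> - real d / 2)"
proof (intro conjI impI)
  have mu: "mu_max m TYPE('n) = flag_bound m d"
    using mu_max_eq[OF assms(1), where 'n = 'n] assms(3) by simp
  show "real (mu_max m TYPE('n)) = real d" if "m = 1 \<or> d = 1"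
    using that by (simp add: mu flag_bound_def)
  show "real (mu_max m TYPE('n)) = real m * real d / 2" if "m \<ge> 2 \<and> even m \<and> d \<ge> 2"
  proof -
    from that obtain q where "m = 2 * q" by blast
    with that show ?thesis unfolding mu by (simp add: flag_bound_def)
  qed
  show "real (mu_max m TYPE('n)) = real m * real d / 2 + of_int \<lfloor>2 * real d / 3\<rfloor> - real d / 2"
    if "m \<ge> 3 \<and> odd m \<and> d \<ge> 2"
  proof -
    have "odd m" "m \<noteq> 1" using that by auto
    then obtain q where q: "m = 2 * q + 3"
      using odd_ge_3E by metis
    have "\<lfloor>2 * real d / 3\<rfloor> = int (2 * d div 3)"
      using floor_divide_of_nat_eq[of "2 * d" 3] by simp
    \<comment> \<open>With \<open>m = 2 * q + 3\<close> the bound becomes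
      \<open>(q + 1) * d + 2 * d div 3\<close>, and \<open>q + 1\<close> is
      \<open>(m - 1) / 2\<close>.\<close>
    moreover have "5 * d div 3 = d + 2 * d div 3"
      by presburger
    ultimately show ?thesis
      using that q unfolding mu by (simp add: flag_bound_def field_simps)
  qed
qed

end
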